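(* Let $N\ge 2$ and let $X=(X_1,\dots,X_N)$ be an N-BBM (killing from the left) started from $X_1(0)=\dots=X_N(0)=0$. Fix $\mu$ with $0\le \mu< v_N$, and for $R>0$ let $$\tau_{R,\mu}:=\inf\{t>0:\ X_1(t)-\mu t\ge R\}.$$ Then there are constants $\alpha,\beta$ depending on $\mu$ (and $N$) but not on $R$ such that $\mathbb{E}[\tau_{R,\mu}]<\alpha+\beta R$ for all $R>0$.
   Context: Brunet–Derrida system in $\mathbb{R}$ with $N\ge2$ particles, score function $s:\mathbb{R}\to\mathbb{R}$ and drift $\mu\in\mathbb{R}$: let $(J_i)_{i\ge0}$ ($J_0=0$) be the jump times of a Poisson process of rate $N$, $(K_i)_{i\ge1}$ i.i.d. uniform on $\{1,\dots,N\}$, and independent standard Brownian motions, all mutually independent. Between jump times each particle moves as an independent Brownian motion with drift $\mu$ (i.e. $B(t)+\mu t$). At each time $J_i$, the particle with minimal score $s(Y_n(J_i^-))$ (ties broken arbitrarily) is removed and replaced by a copy of the particle $Y_{K_i}(J_i^-)$ (equivalently, the minimal-score particle jumps to the position $Y_{K_i}(J_i^-)$; if it is that same particle nothing happens). At all times particles are relabelled so that $Y_1(t)\le\dots\le Y_N(t)$. An N-BBM (killing from the left) is the case $s(x)=x$, $\mu=0$. It is a known fact (cited in the paper) that for an N-BBM, for any initial condition, $X_1(t)/t\to v_N$ and $(X_N(t)-X_1(t))/t\to0$ almost surely as $t\to\infty$, where $v_N>0$ is a deterministic constant depending only on $N$; $v_N$ is called the asymptotic speed of the N-BBM. *)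

theory Defs
  imports "HOL-Probability.Probability"
begin

definition std_BM :: "'a measure \<Rightarrow> (real \<Rightarrow> 'a \<Rightarrow> real) \<Rightarrow> bool" where
  "std_BM M B \<longleftrightarrow>
     (\<forall>t. B t \<in> borel_measurable M) \<and>
     (AE \<omega> in M. B 0 \<omega> = 0 \<and> continuous_on {0..} (\<lambda>t. B t \<omega>)) \<and>
     (\<forall>s t. 0 \<le> s \<longrightarrow> s < t \<longrightarrow>
        distributed M lborel (\<lambda>\<omega>. B t \<omega> - B s \<omega>) (normal_density 0 (sqrt (t - s)))) \<and>
     (\<forall>ts. sorted_wrt (<) ts \<longrightarrow> (\<forall>x\<in>set ts. 0 \<le> x) \<longrightarrow>
        prob_space.indep_vars M (\<lambda>_. borel)
          (\<lambda>i \<omega>. B (ts ! Suc i) \<omega> - B (ts ! i) \<omega>) {..<length ts - 1})"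

datatype noise_src = BM_src nat | E_src nat | K_src nat

text \<open>Generators of the sigma algebras of the individual noise sources:
  the Brownian motion b n (label n), the interarrival time e i, the index k i.\<close>
definition noise_gen ::
  "'a measure \<Rightarrow> (nat \<Rightarrow> real \<Rightarrow> 'a \<Rightarrow> real) \<Rightarrow> (nat \<Rightarrow> 'a \<Rightarrow> real) \<Rightarrow> (nat \<Rightarrow> 'a \<Rightarrow> nat)
    \<Rightarrow> noise_src \<Rightarrow> 'a set set" where
  "noise_gen M B E K s = (case s of
      BM_src n \<Rightarrow> {B n t -` A \<inter> space M | t A. A \<in> sets borel}
    | E_src i \<Rightarrow> {E i -` A \<inter> space M | A. A \<in> sets borel}
    | K_src i \<Rightarrow> {K i -` A \<inter> space M | A. True})"

definition jump_time :: "(nat \<Rightarrow> real) \<Rightarrow> nat \<Rightarrow> real" where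
  "jump_time e i = (\<Sum>k\<in>{1..i}. e k)"

definition order_stat :: "nat \<Rightarrow> (nat \<Rightarrow> real) \<Rightarrow> nat \<Rightarrow> real" where
  "order_stat N z k = sort (map z [0..<N]) ! (k - 1)"

definition min_label :: "nat \<Rightarrow> (nat \<Rightarrow> real) \<Rightarrow> nat" where
  "min_label N z = (LEAST n. n < N \<and> (\<forall>m<N. z n \<le> z m))"

text \<open>Labelled positions right after the i-th jump (all particles start at 0).
  Particle with label n is driven by b n between jumps; at the i-th jump the
  minimal particle jumps to the position of the k i-th ranked particle.\<close>
primrec nbbm_state ::
  "nat \<Rightarrow> (nat \<Rightarrow> real \<Rightarrow> real) \<Rightarrow> (nat \<Rightarrow> real) \<Rightarrow> (nat \<Rightarrow> nat) \<Rightarrow> nat \<Rightarrow> nat \<Rightarrow> real" where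
  "nbbm_state N b e k 0 = (\<lambda>n. 0)"
| "nbbm_state N b e k (Suc i) =
     (let pre = (\<lambda>n. nbbm_state N b e k i n + b n (jump_time e (Suc i)) - b n (jump_time e i))
      in pre(min_label N pre := order_stat N pre (k (Suc i))))"

definition num_jumps :: "(nat \<Rightarrow> real) \<Rightarrow> real \<Rightarrow> nat" where
  "num_jumps e t = (LEAST i. t < jump_time e (Suc i))"

definition nbbm_pos ::
  "nat \<Rightarrow> (nat \<Rightarrow> real \<Rightarrow> real) \<Rightarrow> (nat \<Rightarrow> real) \<Rightarrow> (nat \<Rightarrow> nat) \<Rightarrow> real \<Rightarrow> nat \<Rightarrow> real" where
  "nbbm_pos N b e k t n =
     (let i = num_jumps e t in nbbm_state N b e k i n + b n t - b n (jump_time e i))"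

definition nbbm_X1 ::
  "nat \<Rightarrow> (nat \<Rightarrow> real \<Rightarrow> real) \<Rightarrow> (nat \<Rightarrow> real) \<Rightarrow> (nat \<Rightarrow> nat) \<Rightarrow> real \<Rightarrow> real" where
  "nbbm_X1 N b e k t = Min ((nbbm_pos N b e k t) ` {..<N})"

text \<open>Hitting time tau_{R,mu} = inf{t>0 : X_1(t) - mu t \<ge> R}, valued in [0,\<infinity>] (inf {} = \<infinity>).\<close>
definition hit_time :: "(real \<Rightarrow> real) \<Rightarrow> real \<Rightarrow> real \<Rightarrow> ennreal" where
  "hit_time X1 \<mu> R = Inf {ennreal t | t. 0 < t \<and> X1 t - \<mu> * t \<ge> R}"

end

theory Submission
  imports Defs
begin

text \<open>Look at the particle system only at its jump times. Conditionally on the waiting times, the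
  Brownian increments between jumps are independent Gaussians, so the normalised increments, the
  waiting times and the ranks are all independent, and the embedded chain is a Markov chain driven by
  i.i.d. innovations. Order configurations by domination up to a relabelling of the particles; the
  chain is monotone for this order, because the Gaussian innovations are exchangeable. Hence the gain
  of \<open>X\<^sub>1 - \<mu> t\<close> over \<open>L\<close> jumps, started from any configuration, dominates in law the gain
  started from all particles at one point.

  For large \<open>L\<close> the latter, truncated from above, has positive mean: the assumed speed makes it
  at least \<open>c L\<close> with probability close to 1, and its negative part is uniformly integrable after
  division by \<open>L\<close>, being bounded by a sum of \<open>L\<close> square integrable innovations. Wald's identity
  for the first passage of the chain, observed every \<open>L\<close> jumps, above \<open>R\<close> gives the linear bound.\<close>

section \<open>Order statistics and the deterministic jump map\<close>

text \<open>Killing and branching move labels around, so an order comparing particles label by label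
  is not preserved by a jump. Allowing a relabelling repairs this, but then the innovations must
  have a law invariant under permutations. Dividing each Brownian increment by the square root of
  its waiting time achieves that: at frozen times the quotient is standard Gaussian whatever the
  times are, so it stays independent of the clock although it is read off at random times.

  The quantity that is integrated throughout is the deficit \<open>C - min C D\<close> of a block
  gain \<open>D\<close>. It is nonnegative, so \<open>ennreal\<close> integrals suffice and no level
  has to be integrable beforehand; it decreases in \<open>D\<close>, so a lower comparison of gains
  is an upper bound on it; and truncation keeps the overshoot at the passage of \<open>R\<close>
  below \<open>C\<close>. A block lasts \<open>L / N\<close> on average, and at most
  \<open>2 * (R + C) / C\<close> blocks are begun in expectation. This yields \<alpha> and \<beta>;
  an extra 1 in \<alpha> makes the inequality strict.\<close>

lemma sorted_nth_le_iff:
  fixes xs :: "'a::linorder list"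
  assumes "sorted xs" "i < length xs"
  shows "xs ! i \<le> c \<longleftrightarrow> i < length (filter (\<lambda>x. x \<le> c) xs)"
  using assms
proof (induction xs arbitrary: i)
  case (Cons x xs)
  show ?case
  proof (cases "x \<le> c")
    case True
    then show ?thesis using Cons by (cases i) auto
  next
    case False
    then have "\<And>y. y \<in> set (x # xs) \<Longrightarrow> \<not> y \<le> c"
      using Cons.prems(1) by auto
    moreover from this have "filter (\<lambda>x. x \<le> c) (x # xs) = []"
      by (simp only: filter_empty_conv) blast
    ultimately show ?thesis using Cons.prems(2) nth_mem by (metis gr_implies_not0 list.size(3))
  qed
qed simp

text \<open>The counting form gets rid of sorting: monotonicity and measurability of
  \<open>order_stat\<close> are both derived from it.\<close>

lemma order_stat_le_iff:
  assumes "1 \<le> k" "k \<le> N"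
  shows "order_stat N z k \<le> c \<longleftrightarrow> k \<le> card {n\<in>{..<N}. z n \<le> c}"
proof -
  let ?xs = "sort (map z [0..<N])"
  have "length (filter (\<lambda>x. x \<le> c) ?xs) = length (filter (\<lambda>x. x \<le> c) (map z [0..<N]))"
    by (metis mset_filter mset_sort size_mset)
  also have "\<dots> = length (filter (\<lambda>n. z n \<le> c) [0..<N])"
    by (simp add: filter_map comp_def)
  also have "\<dots> = card (set (filter (\<lambda>n. z n \<le> c) [0..<N]))"
    by (rule distinct_card[symmetric]) simp
  also have "set (filter (\<lambda>n. z n \<le> c) [0..<N]) = {n\<in>{..<N}. z n \<le> c}"
    by auto
  finally show ?thesis
    using sorted_nth_le_iff[of ?xs "k - 1" c] assms unfolding order_stat_def by auto
qed

lemma order_stat_cong: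
  assumes "\<And>n. n < N \<Longrightarrow> x n = y n"
  shows "order_stat N x k = order_stat N y k"
proof -
  have "map x [0..<N] = map y [0..<N]" using assms by auto
  then show ?thesis by (simp only: order_stat_def)
qed

text \<open>The entries of \<open>y\<close> at most \<open>d\<close> pull back along
  \<open>p\<close> to entries of \<open>x\<close> at most \<open>d + c\<close>, so the count for
  \<open>x\<close> is at least as large. The shift \<open>c\<close> will absorb a difference of
  reference levels.\<close>

lemma order_stat_mono_perm:
  assumes p: "p permutes {..<N}" and le: "\<And>n. n < N \<Longrightarrow> x n \<le> y (p n) + c"
    and k: "1 \<le> k" "k \<le> N"
  shows "order_stat N x k \<le> order_stat N y k + c"
proof -
  let ?d = "order_stat N y k"
  have "k \<le> card {n\<in>{..<N}. y n \<le> ?d}"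
    using order_stat_le_iff[OF k] by blast
  also have "{n\<in>{..<N}. y n \<le> ?d} = p ` {n\<in>{..<N}. y (p n) \<le> ?d}"
  proof safe
    fix n assume "n < N" "y n \<le> ?d"
    then show "n \<in> p ` {n\<in>{..<N}. y (p n) \<le> ?d}"
      using permutes_image[OF p] by (auto simp: image_iff) (metis (no_types) p permutes_inverses(1) permutes_inv lessThan_iff permutes_in_image)
  qed (use p permutes_in_image[OF p] in auto)
  also have "card \<dots> \<le> card {n\<in>{..<N}. y (p n) \<le> ?d}"
    by (rule card_image_le) simp
  also have "\<dots> \<le> card {n\<in>{..<N}. x n \<le> ?d + c}"
    by (rule card_mono) (use le in force)+
  finally show ?thesis using order_stat_le_iff[OF k] by blast
qed

lemma min_label_props:
  assumes "0 < N"
  shows "min_label N z < N" and "\<And>m. m < N \<Longrightarrow> z (min_label N z) \<le> z m"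
proof -
  have "Min (z ` {..<N}) \<in> z ` {..<N}" using assms by (intro Min_in) auto
  then obtain n where "n < N" "z n = Min (z ` {..<N})" by auto
  then have "n < N \<and> (\<forall>m<N. z n \<le> z m)" by auto
  then have "min_label N z < N \<and> (\<forall>m<N. z (min_label N z) \<le> z m)"
    unfolding min_label_def by (rule LeastI)
  then show "min_label N z < N" "\<And>m. m < N \<Longrightarrow> z (min_label N z) \<le> z m" by auto
qed

lemma min_label_cong:
  assumes "\<And>n. n < N \<Longrightarrow> x n = y n"
  shows "min_label N x = min_label N y"
  unfolding min_label_def by (rule arg_cong[where f=Least]) (use assms in auto)

text \<open>The last conjunct encodes the tie-breaking by least label. Only finitely many
  comparisons of coordinates occur, which is the form that measurability needs.\<close>

lemma min_label_eq_iff: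
  assumes "0 < N"
  shows "min_label N z = n \<longleftrightarrow> n < N \<and> (\<forall>m<N. z n \<le> z m) \<and> (\<forall>l<n. \<exists>m<N. z m < z l)"
proof
  assume *: "min_label N z = n"
  have "\<exists>m<N. z m < z l" if "l < n" for l
    using not_less_Least[of l "\<lambda>n. n < N \<and> (\<forall>m<N. z n \<le> z m)"] that min_label_props[OF assms, where z=z] *
    unfolding min_label_def by (metis (no_types, lifting) less_trans linorder_not_le)
  then show "n < N \<and> (\<forall>m<N. z n \<le> z m) \<and> (\<forall>l<n. \<exists>m<N. z m < z l)"
    using min_label_props[OF assms, where z=z] * by auto
next
  assume "n < N \<and> (\<forall>m<N. z n \<le> z m) \<and> (\<forall>l<n. \<exists>m<N. z m < z l)"
  then show "min_label N z = n"
    unfolding min_label_def by (intro Least_equality) (auto, meson linorder_not_le)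
qed

text \<open>The restriction to \<open>{..<N}\<close> makes the result an element of the product
  space over \<open>{..<N}\<close>, whose points are extensional functions.\<close>

definition cull :: "nat \<Rightarrow> nat \<Rightarrow> (nat \<Rightarrow> real) \<Rightarrow> nat \<Rightarrow> real" where
  "cull N k x = (\<lambda>n\<in>{..<N}. if n = min_label N x then order_stat N x k else x n)"

lemma cull_cong:
  assumes "\<And>n. n < N \<Longrightarrow> x n = y n"
  shows "cull N k x = cull N k y"
  unfolding cull_def using order_stat_cong[OF assms] min_label_cong[OF assms] assms
  by (auto simp: fun_eq_iff)

text \<open>The old matching \<open>p\<close> may fail after the jump, since it need not pair the
  minimal particle of \<open>x\<close> with that of \<open>y\<close>. These two receive the same
  order statistic and must be matched; the partners they lose are then matched with each
  other.\<close>

lemma cull_dominated: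
  assumes N: "0 < N" and k: "1 \<le> k" "k \<le> N"
    and p: "p permutes {..<N}" and le: "\<And>n. n < N \<Longrightarrow> x n \<le> y (p n) + c"
  shows "\<exists>q. q permutes {..<N} \<and> (\<forall>n<N. cull N k x n \<le> cull N k y (q n) + c)"
proof -
  define a b where "a = min_label N x" and "b = min_label N y"
  have a: "a < N" "\<And>m. m < N \<Longrightarrow> x a \<le> x m" and b: "b < N" "\<And>m. m < N \<Longrightarrow> y b \<le> y m"
    using min_label_props[OF N] unfolding a_def b_def by auto
  define a' where "a' = inv p b"
  have a': "a' < N" "p a' = b"
    using b(1) permutes_in_image[OF permutes_inv[OF p]] permutes_inverses(1)[OF p] by (auto simp: a'_def)
  \<comment> \<open>With \<open>a'\<close> the old partner of the minimum \<open>b\<close> of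
    \<open>y\<close>, the swap sends \<open>a\<close> to \<open>b\<close> and \<open>a'\<close> to
    \<open>p a\<close>. The second pair is still ordered because \<open>x a' \<le> y b + c\<close>
    and \<open>y b\<close> is minimal.\<close>
  define q where "q = p \<circ> Transposition.transpose a a'"
  have q: "q permutes {..<N}"
    unfolding q_def by (rule permutes_compose[OF permutes_swap_id p]) (use a a' in auto)
  have pN: "p n < N" if "n < N" for n using permutes_in_image[OF p, of n] that by auto
  have "cull N k x n \<le> cull N k y (q n) + c" if n: "n < N" for n
  proof (cases "n = a")
    case True
    then show ?thesis
      using order_stat_mono_perm[of p N x y c k] p le k a' b a by (simp add: cull_def q_def flip: a_def b_def)
  next
    case na: False
    show ?thesis
    proof (cases "n = a'")
      case True
      have "p a \<noteq> b" using True na a' permutes_inj[OF p] by (metis injD)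
      moreover have "y b \<le> y (p a)" using b(2) pN a by auto
      ultimately have "x a' \<le> y (p a) + c" using le[OF n] True a'(2) by auto
      then show ?thesis
        using \<open>p a \<noteq> b\<close> True na n a' a pN by (simp add: cull_def q_def flip: a_def b_def)
    next
      case False
      have "p n \<noteq> b" using False a' permutes_inj[OF p] by (metis injD)
      then show ?thesis
        using False na n le[OF n] pN by (simp add: cull_def q_def Transposition.transpose_def flip: a_def b_def)
    qed
  qed
  then show ?thesis using q by blast
qed

lemma Min_cull_ge:
  assumes N: "0 < N" and k: "1 \<le> k" "k \<le> N" and le: "\<And>n. n < N \<Longrightarrow> c \<le> x n"
  shows "n < N \<Longrightarrow> c \<le> cull N k x n"
proof -
  assume n: "n < N"
  \<comment> \<open>Comparison with the constant configuration 0, all of whose order statistics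
    vanish.\<close>
  have "order_stat N (\<lambda>_. 0) k \<le> order_stat N x k + - c"
    by (rule order_stat_mono_perm[OF permutes_id]) (use le k in auto)
  moreover have "0 \<le> order_stat N (\<lambda>_. 0) k"
  proof -
    have "\<forall>z\<in>set (sort (map (\<lambda>_. 0::real) [0..<N])). z = 0" by auto
    then have "order_stat N (\<lambda>_. 0) k = 0"
      unfolding order_stat_def using k by (metis One_nat_def Suc_le_eq Suc_pred diff_zero length_map length_sort length_upt nth_mem le_less_trans less_le_trans lessI)
    then show ?thesis by simp
  qed
  ultimately show "c \<le> cull N k x n" using le[OF n] n by (simp add: cull_def)
qed

text \<open>The innovation \<open>u\<close> of one jump carries \<open>N\<close> normalised Brownian increments, the waiting time
  \<open>u N\<close> and the rank \<open>u (Suc N)\<close>. In a state \<open>(x, s)\<close>, \<open>s\<close> is a reference level moving at speed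
  \<open>\<mu>\<close>; ranks are clamped to \<open>{1..N}\<close>, since \<open>order_stat\<close> is junk outside this range.\<close>
definition step_pre :: "nat \<Rightarrow> (nat \<Rightarrow> real) \<Rightarrow> (nat \<Rightarrow> real) \<Rightarrow> nat \<Rightarrow> real" where
  "step_pre N u x = (\<lambda>n\<in>{..<N}. x n + sqrt (u N) * u n)"

definition rank_of :: "nat \<Rightarrow> real \<Rightarrow> nat" where
  "rank_of N r = max 1 (min N (nat \<lfloor>r\<rfloor>))"

definition nstep :: "nat \<Rightarrow> real \<Rightarrow> (nat \<Rightarrow> real) \<Rightarrow> (nat \<Rightarrow> real) \<times> real \<Rightarrow> (nat \<Rightarrow> real) \<times> real" where
  "nstep N \<mu> u z = (cull N (rank_of N (u (Suc N))) (step_pre N u (fst z)), snd z + \<mu> * u N)"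

definition height :: "nat \<Rightarrow> (nat \<Rightarrow> real) \<times> real \<Rightarrow> real" where
  "height N z = Min (fst z ` {..<N}) - snd z"

text \<open>Equivalently, the sorted configurations, each measured from its own reference level, are
  ordered coordinate by coordinate.\<close>

definition dominated :: "nat \<Rightarrow> (nat \<Rightarrow> real) \<times> real \<Rightarrow> (nat \<Rightarrow> real) \<times> real \<Rightarrow> bool" where
  "dominated N z w \<longleftrightarrow>
     (\<exists>p. p permutes {..<N} \<and> (\<forall>n<N. fst z n - snd z \<le> fst w (p n) - snd w))"

lemma rank_of_range: "0 < N \<Longrightarrow> 1 \<le> rank_of N r" "0 < N \<Longrightarrow> rank_of N r \<le> N"
  by (auto simp: rank_of_def)

text \<open>Matched particles \<open>n\<close> and \<open>p n\<close> receive the same Gaussian.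
  Since \<open>p\<close> moves only labels below \<open>N\<close>, both systems share the waiting
  time \<open>u N\<close> and the rank \<open>u (Suc N)\<close>, so the matching survives the motion
  and \<open>cull_dominated\<close> handles the jump.\<close>

lemma nstep_dominated:
  assumes N: "0 < N" and p: "p permutes {..<N}"
    and le: "\<And>n. n < N \<Longrightarrow> fst z n - snd z \<le> fst w (p n) - snd w"
  shows "dominated N (nstep N \<mu> u z) (nstep N \<mu> (\<lambda>n\<in>{..<N + 2}. u (inv p n)) w)"
proof -
  let ?u = "\<lambda>n\<in>{..<N + 2}. u (inv p n)"
  have fix_N: "inv p N = N" "inv p (Suc N) = Suc N"
    using permutes_inv[OF p] by (auto simp: permutes_def)
  have pN: "p n < N" if "n < N" for n using permutes_in_image[OF p, of n] that by auto
  have "\<exists>q. q permutes {..<N} \<and>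
      (\<forall>n<N. cull N (rank_of N (u (Suc N))) (step_pre N u (fst z)) n
        \<le> cull N (rank_of N (u (Suc N))) (step_pre N ?u (fst w)) (q n) + (snd z - snd w))"
  proof (rule cull_dominated[OF N rank_of_range[OF N] p])
    fix n assume "n < N"
    then show "step_pre N u (fst z) n \<le> step_pre N ?u (fst w) (p n) + (snd z - snd w)"
      using le[of n] pN[of n] permutes_inverses(2)[OF p] fix_N by (simp add: step_pre_def)
  qed
  then show ?thesis
    unfolding dominated_def nstep_def using fix_N by (auto simp: algebra_simps)
qed

lemma height_mono_dominated:
  assumes "0 < N" "dominated N z w"
  shows "height N z \<le> height N w"
proof -
  obtain p where p: "p permutes {..<N}" and le: "\<forall>n<N. fst z n - snd z \<le> fst w (p n) - snd w"
    using assms(2) unfolding dominated_def by auto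
  have "Min (fst w ` {..<N}) \<in> fst w ` {..<N}" using assms by (intro Min_in) auto
  then obtain m where m: "m < N" "Min (fst w ` {..<N}) = fst w m" by auto
  have "inv p m < N" "p (inv p m) = m"
    using m permutes_in_image[OF permutes_inv[OF p], of m] permutes_inverses(1)[OF p] by auto
  then have "fst z (inv p m) - snd z \<le> fst w m - snd w" using le by metis
  moreover have "Min (fst z ` {..<N}) \<le> fst z (inv p m)"
    using \<open>inv p m < N\<close> by (intro Min_le) auto
  ultimately show ?thesis unfolding height_def using m by linarith
qed

text \<open>The point of this crude bound is that the product \<open>sqrt (u N) * u n\<close> is
  replaced by a sum of separate functions of the innovations, each with a finite second moment. The
  jump itself cannot lower the minimum.\<close>

lemma height_nstep_ge:
  fixes \<mu> :: real
  assumes N: "0 < N" and u: "0 \<le> u N"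
  shows "height N z - (\<bar>\<mu>\<bar> + N) * u N - (\<Sum>n<N. (u n)\<^sup>2) \<le> height N (nstep N \<mu> u z)"
proof -
  let ?c = "Min (fst z ` {..<N}) - N * u N - (\<Sum>n<N. (u n)\<^sup>2)"
  have "?c \<le> step_pre N u (fst z) n" if n: "n < N" for n
  proof -
    \<comment> \<open>Completing the square separates the waiting time from the Gaussian.\<close>
    have "0 \<le> (sqrt (u N) + u n / 2)\<^sup>2" by simp
    also have "\<dots> = u N + sqrt (u N) * u n + (u n)\<^sup>2 / 4"
      using u by (simp add: power2_sum power_divide)
    finally have 1: "- u N - (u n)\<^sup>2 \<le> sqrt (u N) * u n"
      using zero_le_power2[of "u n"] by linarith
    have 2: "(u n)\<^sup>2 \<le> (\<Sum>n<N. (u n)\<^sup>2)" by (rule member_le_sum) (use n in auto)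
    have 3: "1 * u N \<le> N * u N" by (rule mult_right_mono) (use N u in auto)
    have "Min (fst z ` {..<N}) \<le> fst z n" using n by (intro Min_le) auto
    then have "?c \<le> fst z n + sqrt (u N) * u n" using 1 2 3 by linarith
    then show ?thesis using n by (simp add: step_pre_def)
  qed
  from Min_cull_ge[OF N rank_of_range[OF N] this]
  have "?c \<le> Min (fst (nstep N \<mu> u z) ` {..<N})"
    using N by (subst Min_ge_iff) (auto simp: nstep_def)
  moreover have "\<mu> * u N \<le> \<bar>\<mu>\<bar> * u N" using u by (intro mult_right_mono) auto
  ultimately show ?thesis by (simp add: height_def nstep_def algebra_simps)
qed

section \<open>The chain driven by a sequence of innovations and its agreement with the particle
  system\<close>

primrec nchain :: "nat \<Rightarrow> real \<Rightarrow> (nat \<Rightarrow> nat \<Rightarrow> real) \<Rightarrow> nat \<Rightarrow> (nat \<Rightarrow> real) \<times> real" where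
  "nchain N \<mu> u 0 = (\<lambda>n\<in>{..<N}. 0, 0)"
| "nchain N \<mu> u (Suc i) = nstep N \<mu> (u (Suc i)) (nchain N \<mu> u i)"

lemma snd_nchain: "snd (nchain N \<mu> u i) = \<mu> * (\<Sum>j=1..i. u j N)"
  by (induction i) (auto simp: nstep_def algebra_simps)

lemma height_nchain_0: "0 < N \<Longrightarrow> height N (nchain N \<mu> u 0) = 0"
  by (simp add: height_def image_constant_conv lessThan_empty_iff)

lemma height_nchain_ge:
  fixes \<mu> :: real
  assumes N: "0 < N" and u: "\<And>i. 1 \<le> i \<Longrightarrow> 0 \<le> u i N"
  shows "- (\<Sum>j=1..i. (\<bar>\<mu>\<bar> + N) * u j N + (\<Sum>n<N. (u j n)\<^sup>2)) \<le> height N (nchain N \<mu> u i)"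
proof (induction i)
  case 0
  show ?case using height_nchain_0[OF N, of \<mu> u] by simp
next
  case (Suc i)
  then show ?case
    using height_nstep_ge[OF N, of "u (Suc i)" "nchain N \<mu> u i" \<mu>] u[of "Suc i"] by simp
qed

lemma nbbm_state_eq_nchain:
  assumes N: "0 < N"
    and incr: "\<And>i n. n < N \<Longrightarrow>
      sqrt (u (Suc i) N) * u (Suc i) n = b n (jump_time e (Suc i)) - b n (jump_time e i)"
    and rank: "\<And>i. rank_of N (u (Suc i) (Suc N)) = k (Suc i)"
    and n: "n < N"
  shows "nbbm_state N b e k i n = fst (nchain N \<mu> u i) n"
  using n
proof (induction i arbitrary: n)
  case (Suc i)
  let ?pre = "\<lambda>n. nbbm_state N b e k i n + b n (jump_time e (Suc i)) - b n (jump_time e i)"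
  have "?pre n = step_pre N (u (Suc i)) (fst (nchain N \<mu> u i)) n" if "n < N" for n
    using that Suc.IH[OF that] incr[OF that] by (simp add: step_pre_def)
  from cull_cong[where N=N, OF this]
  have "cull N (k (Suc i)) ?pre n = fst (nchain N \<mu> u (Suc i)) n"
    by (simp add: nstep_def rank)
  moreover have "nbbm_state N b e k (Suc i) n = cull N (k (Suc i)) ?pre n"
    using Suc.prems by (simp add: cull_def Let_def)
  ultimately show ?case by simp
qed simp

text \<open>The strict inequality in \<open>num_jumps\<close> counts a jump at its own time, so the
  system is read just after the jump. Positive waiting times exclude coinciding jump times.\<close>

lemma num_jumps_jump_time:
  assumes pos: "\<And>i. 1 \<le> i \<Longrightarrow> 0 < e i"
  shows "num_jumps e (jump_time e i) = i"
proof -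
  have mono: "jump_time e a \<le> jump_time e b" if "a \<le> b" for a b
    unfolding jump_time_def proof (rule sum_mono2)
    fix i assume "i \<in> {1..b} - {1..a}"
    then show "0 \<le> e i" using pos[of i] by auto
  qed (use that in auto)
  have "jump_time e i < jump_time e (Suc i)"
    using pos[of "Suc i"] by (simp add: jump_time_def)
  then show ?thesis
    unfolding num_jumps_def by (intro Least_equality) (auto, meson mono not_less not_less_eq_eq)
qed

lemma nbbm_X1_jump_time:
  assumes N: "0 < N" and pos: "\<And>i. 1 \<le> i \<Longrightarrow> 0 < e i"
    and state: "\<And>n. n < N \<Longrightarrow> nbbm_state N b e k i n = x n"
  shows "nbbm_X1 N b e k (jump_time e i) = Min (x ` {..<N})"
  unfolding nbbm_X1_def
  by (rule arg_cong[where f=Min], rule image_cong)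
     (auto simp: nbbm_pos_def num_jumps_jump_time[OF pos] state)

section \<open>Independence of the innovations\<close>

text \<open>Evaluates a path at time \<open>t\<close> through its values at dyadic times, so that Brownian motion at a
  random time is measurable although only almost every path is continuous.\<close>
definition dlim :: "(real \<Rightarrow> real) \<Rightarrow> real \<Rightarrow> real" where
  "dlim f t = lim (\<lambda>k. f (real_of_int \<lceil>2 ^ k * t\<rceil> / 2 ^ k))"

text \<open>Rounding up keeps the dyadic times in the half-line on which the path is
  continuous.\<close>

lemma dlim_continuous:
  assumes cont: "continuous_on {0..} f" and t: "0 \<le> t"
  shows "dlim f t = f t"
proof -
  let ?a = "\<lambda>k::nat. real_of_int \<lceil>2 ^ k * t\<rceil> / 2 ^ k"
  have lower: "t \<le> ?a k" for k
    by (simp add: field_simps)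
  have upper: "?a k \<le> t + (1 / 2) ^ k" for k
    by (simp add: field_simps power_divide) linarith
  have "(\<lambda>k. t + (1 / 2) ^ k) \<longlonglongrightarrow> t + 0"
    by (intro tendsto_intros) auto
  then have lim: "?a \<longlonglongrightarrow> t"
    using tendsto_sandwich[of "\<lambda>_. t" ?a sequentially "\<lambda>k. t + (1 / 2) ^ k" t] lower upper by simp
  have "(\<lambda>k. f (?a k)) \<longlonglongrightarrow> f t"
    by (rule continuous_on_tendsto_compose[OF cont lim])
       (use t order_trans[OF t lower] in simp_all)
  then show ?thesis unfolding dlim_def by (rule limI)
qed

text \<open>At each dyadic scale the rounded time takes countably many values, so evaluation is
  measurable piece by piece, and limits preserve this. The map \<open>Y\<close> allows the path and
  the time to depend on different coordinates of a product.\<close>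

lemma measurable_dlim:
  assumes X: "\<And>t. X t \<in> borel_measurable S" and Y: "Y \<in> measurable Q S" and T: "T \<in> borel_measurable Q"
  shows "(\<lambda>\<omega>. dlim (\<lambda>t. X t (Y \<omega>)) (T \<omega>)) \<in> borel_measurable Q"
  unfolding dlim_def
proof (rule borel_measurable_lim_metric)
  fix k :: nat
  have "(\<lambda>\<omega>. \<lceil>2 ^ k * T \<omega>\<rceil>) \<in> measurable Q (count_space UNIV)"
    using T by measurable
  then show "(\<lambda>\<omega>. X (real_of_int \<lceil>2 ^ k * T \<omega>\<rceil> / 2 ^ k) (Y \<omega>)) \<in> borel_measurable Q"
    by (rule measurable_compose_countable[where f="\<lambda>j \<omega>. X (real_of_int j / 2 ^ k) (Y \<omega>)", rotated])
       (rule measurable_compose[OF Y X])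
qed

text \<open>Independence of two sub-sigma-algebras in the form that Fubini's theorem can use: the
  diagonal map has a product law. It takes the place of conditional expectations.\<close>

lemma (in prob_space) distr_diagonal_indep:
  assumes indep: "indep_set (sets S) (sets T)" and space: "space S = space M" "space T = space M"
  shows "distr M (S \<Otimes>\<^sub>M T) (\<lambda>\<omega>. (\<omega>, \<omega>)) = distr M S (\<lambda>\<omega>. \<omega>) \<Otimes>\<^sub>M distr M T (\<lambda>\<omega>. \<omega>)"
proof -
  have eq: "sigma_sets (space M) {(\<lambda>\<omega>. \<omega>) -` A \<inter> space M | A. A \<in> sets U} = sets U"
    if "space U = space M" for U :: "'a measure"
  proof -
    have "{(\<lambda>\<omega>. \<omega>) -` A \<inter> space M | A. A \<in> sets U} = sets U"
      using sets.sets_into_space[of _ U] that by auto (metis Int_absorb2)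
    then show ?thesis using sets.sigma_sets_eq[of U] that by simp
  qed
  have "(\<lambda>\<omega>. \<omega>) \<in> measurable M S" "(\<lambda>\<omega>. \<omega>) \<in> measurable M T"
    using indep_setD_ev1[OF indep] indep_setD_ev2[OF indep] space
    by (auto simp: measurable_def sets.sets_into_space Int_absorb2)
  then have "indep_var S (\<lambda>\<omega>. \<omega>) T (\<lambda>\<omega>. \<omega>)"
    unfolding indep_var_eq eq[OF space(1)] eq[OF space(2)] using indep by simp
  then show ?thesis unfolding indep_var_distribution_eq by simp
qed

lemma (in prob_space) indep_vars_inj_reindex:
  assumes inj: "inj_on f I" and indep: "indep_vars (\<lambda>_. S) X (f ` I)"
  shows "indep_vars (\<lambda>_. S) (\<lambda>i. X (f i)) I"
  unfolding indep_vars_def2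
proof (intro conjI ballI)
  fix i assume "i \<in> I"
  then show "random_variable S (X (f i))" using indep by (auto simp: indep_vars_def2)
next
  have ind: "indep_sets (\<lambda>j. {X j -` A \<inter> space M | A. A \<in> sets S}) (f ` I)"
    using indep by (simp add: indep_vars_def2)
  show "indep_sets (\<lambda>i. {X (f i) -` A \<inter> space M | A. A \<in> sets S}) I"
  proof (rule indep_setsI)
    fix i assume "i \<in> I"
    then show "{X (f i) -` A \<inter> space M | A. A \<in> sets S} \<subseteq> events"
      using ind by (auto simp: indep_sets_def)
  next
    fix A J assume J: "J \<noteq> {}" "J \<subseteq> I" "finite J"
      and A: "\<forall>j\<in>J. A j \<in> {X (f j) -` A \<inter> space M | A. A \<in> sets S}"
    have injJ: "inj_on f J" using inj J(2) by (rule inj_on_subset)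
    have "prob (\<Inter>j\<in>f ` J. A (inv_into J f j)) = (\<Prod>j\<in>f ` J. prob (A (inv_into J f j)))"
      by (rule indep_setsD[OF ind]) (use J A injJ in auto)
    moreover have "(\<Inter>j\<in>f ` J. A (inv_into J f j)) = (\<Inter>j\<in>J. A j)"
      using injJ by auto
    moreover have "(\<Prod>j\<in>f ` J. prob (A (inv_into J f j))) = (\<Prod>j\<in>J. prob (A j))"
      using injJ by (simp add: prod.reindex)
    ultimately show "prob (\<Inter>j\<in>J. A j) = (\<Prod>j\<in>J. prob (A j))" by simp
  qed
qed

section \<open>Brownian paths and the jump clock as independent sources\<close>

locale nbbm_noise = prob_space M for M :: "'a measure" +
  fixes N :: nat and B :: "nat \<Rightarrow> real \<Rightarrow> 'a \<Rightarrow> real" and E :: "nat \<Rightarrow> 'a \<Rightarrow> real" and K :: "nat \<Rightarrow> 'a \<Rightarrow> nat"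
  assumes N_ge: "2 \<le> N"
    and BM: "\<And>n. n < N \<Longrightarrow> std_BM M (B n)"
    and Exp: "\<And>i. i \<ge> 1 \<Longrightarrow> distributed M lborel (E i) (exponential_density (real N))"
    and Unif: "\<And>i. i \<ge> 1 \<Longrightarrow> distr M (count_space UNIV) (K i) = measure_pmf (pmf_of_set {1..N})"
    and indep_noise: "indep_sets (\<lambda>s. sigma_sets (space M) (noise_gen M B E K s))
                  ({BM_src n | n. n < N} \<union> {E_src i | i. i \<ge> 1} \<union> {K_src i | i. i \<ge> 1})"
begin

lemma N_pos: "0 < N" using N_ge by simp

abbreviation gen :: "noise_src \<Rightarrow> 'a set set" where "gen \<equiv> noise_gen M B E K"

abbreviation gauss :: "real measure" where "gauss \<equiv> density lborel std_normal_density"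

definition arrival :: "nat \<Rightarrow> 'a \<Rightarrow> real" where "arrival i \<omega> = jump_time (\<lambda>i. E i \<omega>) i"

lemma gen_subset: "gen s \<subseteq> Pow (space M)"
  by (cases s) (auto simp: noise_gen_def)

definition src_algebra :: "noise_src set \<Rightarrow> 'a measure" where
  "src_algebra I = sigma (space M) (\<Union>s\<in>I. sigma_sets (space M) (gen s))"

lemma src_subset: "(\<Union>s\<in>I. sigma_sets (space M) (gen s)) \<subseteq> Pow (space M)"
  using sigma_sets_into_sp[OF gen_subset] by blast

lemma space_src_algebra[simp]: "space (src_algebra I) = space M"
  by (simp add: src_algebra_def space_measure_of[OF src_subset])

lemma sets_src_algebra: "sets (src_algebra I) = sigma_sets (space M) (\<Union>s\<in>I. sigma_sets (space M) (gen s))"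
  by (simp add: src_algebra_def sets_measure_of[OF src_subset])

lemma gen_in_src: "s \<in> I \<Longrightarrow> A \<in> gen s \<Longrightarrow> A \<in> sets (src_algebra I)"
  unfolding sets_src_algebra by (auto intro!: sigma_sets.Basic)

lemma measurable_src_B: "BM_src n \<in> I \<Longrightarrow> B n t \<in> borel_measurable (src_algebra I)"
  by (rule measurableI) (auto intro!: gen_in_src[of "BM_src n"] simp: noise_gen_def, blast)

lemma measurable_src_E: "E_src i \<in> I \<Longrightarrow> E i \<in> borel_measurable (src_algebra I)"
  by (rule measurableI) (auto intro!: gen_in_src[of "E_src i"] simp: noise_gen_def, blast)

lemma measurable_src_K: "K_src i \<in> I \<Longrightarrow> K i \<in> measurable (src_algebra I) (count_space UNIV)"
  by (rule measurableI) (auto intro!: gen_in_src[of "K_src i"] simp: noise_gen_def, blast)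

lemma sets_src_single: "sets (src_algebra {s}) = sigma_sets (space M) (gen s)"
  by (simp add: sets_src_algebra sigma_sets_sigma_sets_eq[OF gen_subset])

definition bm_srcs :: "noise_src set" where "bm_srcs = {BM_src n | n. n < N}"

definition jump_srcs :: "noise_src set" where
  "jump_srcs = {E_src i | i. i \<ge> 1} \<union> {K_src i | i. i \<ge> 1}"

lemma srcs_iff[simp]: "BM_src n \<in> bm_srcs \<longleftrightarrow> n < N" "E_src i \<in> jump_srcs \<longleftrightarrow> 1 \<le> i" "K_src i \<in> jump_srcs \<longleftrightarrow> 1 \<le> i"
  by (auto simp: bm_srcs_def jump_srcs_def)

lemma Int_stable_sigma_gen: "Int_stable (sigma_sets (space M) (gen s))"
proof -
  interpret sigma_algebra "space M" "sigma_sets (space M) (gen s)"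
    by (rule sigma_algebra_sigma_sets[OF gen_subset])
  show ?thesis by (auto intro!: Int_stableI)
qed

text \<open>Collecting disjoint groups of independent families that are stable under intersection
  preserves independence; the groups are the Brownian motions on one side, waiting times and ranks
  on the other.\<close>

lemma indep_srcs: "indep_set (sets (src_algebra bm_srcs)) (sets (src_algebra jump_srcs))"
proof -
  have "indep_sets (\<lambda>j. sigma_sets (space M) (\<Union>s\<in>case_bool bm_srcs jump_srcs j. sigma_sets (space M) (gen s))) UNIV"
  proof (rule indep_sets_collect_sigma)
    show "indep_sets (\<lambda>s. sigma_sets (space M) (gen s)) (\<Union>j. case_bool bm_srcs jump_srcs j)"
      using indep_noise by (simp add: UNIV_bool bm_srcs_def jump_srcs_def Un_assoc Un_commute Un_left_commute)
    show "disjoint_family (case_bool bm_srcs jump_srcs)"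
      by (auto simp: disjoint_family_on_def bm_srcs_def jump_srcs_def split: bool.splits)
  qed (rule Int_stable_sigma_gen)
  then show ?thesis
    unfolding indep_set_def sets_src_algebra by (rule indep_sets_mono_sets) (auto split: bool.split)
qed

lemma sets_src_subset: "sets (src_algebra bm_srcs) \<subseteq> events" "sets (src_algebra jump_srcs) \<subseteq> events"
  using indep_setD_ev1[OF indep_srcs] indep_setD_ev2[OF indep_srcs] .

lemma measurable_from_src:
  "f \<in> measurable (src_algebra bm_srcs) Q \<Longrightarrow> f \<in> measurable M Q"
  "f \<in> measurable (src_algebra jump_srcs) Q \<Longrightarrow> f \<in> measurable M Q"
  using sets_src_subset by (auto simp: measurable_def)

lemma measurable_B[measurable]: "n < N \<Longrightarrow> B n t \<in> borel_measurable M"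
  by (rule measurable_from_src(1)) (auto intro: measurable_src_B)

lemma measurable_E: "1 \<le> i \<Longrightarrow> E i \<in> borel_measurable M"
  by (rule measurable_from_src(2)) (auto intro: measurable_src_E)

lemma measurable_K: "1 \<le> i \<Longrightarrow> K i \<in> measurable M (count_space UNIV)"
  by (rule measurable_from_src(2)) (auto intro: measurable_src_K)

lemma measurable_src_arrival: "arrival i \<in> borel_measurable (src_algebra jump_srcs)"
  unfolding arrival_def jump_time_def by (intro borel_measurable_sum measurable_src_E) auto

lemma prob_space_gauss: "prob_space gauss"
  by (rule prob_space_normal_density) simp

text \<open>The times are deterministic here. The right-hand side does not involve them, and this is
  what later makes the law of the normalised increments the same for every frozen clock.\<close>

lemma single_path_increments:
  assumes n: "n < N" and t: "0 \<le> t 0" "\<And>i. t i < t (Suc i)" and A: "\<And>i. A i \<in> sets borel"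
  shows "prob {\<omega>\<in>space M. \<forall>i<m. (B n (t (Suc i)) \<omega> - B n (t i) \<omega>) / sqrt (t (Suc i) - t i) \<in> A i}
    = (\<Prod>i<m. measure gauss (A i))"
proof (cases "m = 0")
  case True
  then show ?thesis by (simp add: prob_space)
next
  case False
  let ?D = "\<lambda>i \<omega>. (B n (t (Suc i)) \<omega> - B n (t i) \<omega>) / sqrt (t (Suc i) - t i)"
  have mono: "strict_mono t" using t(2) by (simp add: strict_mono_Suc_iff)
  have nonneg: "0 \<le> t i" for i
    using t(1) mono by (meson le0 order_trans strict_mono_less_eq)
  let ?ts = "map t [0..<Suc m]"
  have "sorted_wrt (<) ?ts"
    unfolding sorted_wrt_map using mono by (auto simp: sorted_wrt_iff_nth_less strict_mono_less simp del: upt_Suc)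
  moreover have "\<forall>x\<in>set ?ts. 0 \<le> x" using nonneg by auto
  ultimately have "indep_vars (\<lambda>_. borel) (\<lambda>i \<omega>. B n (?ts ! Suc i) \<omega> - B n (?ts ! i) \<omega>) {..<length ?ts - 1}"
    using BM[OF n] unfolding std_BM_def by blast
  also have "?this \<longleftrightarrow> indep_vars (\<lambda>_. borel) (\<lambda>i \<omega>. B n (t (Suc i)) \<omega> - B n (t i) \<omega>) {..<m}"
    by (rule indep_vars_cong) (auto simp del: upt_Suc)
  finally have "indep_vars (\<lambda>_. borel) ?D {..<m}"
    by (rule indep_vars_compose2[where Y="\<lambda>i x. x / sqrt (t (Suc i) - t i)"]) auto
  from indep_varsD_finite[OF this, of A]
  have "prob (\<Inter>i\<in>{..<m}. ?D i -` A i \<inter> space M) = (\<Prod>i<m. prob (?D i -` A i \<inter> space M))"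
    using False A by auto
  also have "(\<Inter>i\<in>{..<m}. ?D i -` A i \<inter> space M) = {\<omega>\<in>space M. \<forall>i<m. ?D i \<omega> \<in> A i}"
    using False by auto
  also have "(\<Prod>i<m. prob (?D i -` A i \<inter> space M)) = (\<Prod>i<m. measure gauss (A i))"
  proof (rule prod.cong[OF refl])
    fix i
    have "distributed M lborel (\<lambda>\<omega>. B n (t (Suc i)) \<omega> - B n (t i) \<omega>) (normal_density 0 (sqrt (t (Suc i) - t i)))"
      using BM[OF n] nonneg t(2) unfolding std_BM_def by blast
    then have D: "distributed M lborel (?D i) std_normal_density"
      using t(2)[of i] normal_standard_normal_convert[of "sqrt (t (Suc i) - t i)" "\<lambda>\<omega>. B n (t (Suc i)) \<omega> - B n (t i) \<omega>" 0]
      by simp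
    then have "gauss = distr M lborel (?D i)" by (rule distributed_distr_eq_density[symmetric])
    then show "prob (?D i -` A i \<inter> space M) = measure gauss (A i)"
      using distributed_measurable[OF D] A by (simp add: measure_distr)
  qed
  finally show ?thesis .
qed

lemma all_path_increments:
  assumes t: "0 \<le> t 0" "\<And>i. t i < t (Suc i)" and A: "\<And>n i. A n i \<in> sets borel"
  shows "prob {\<omega>\<in>space M. \<forall>n<N. \<forall>i<m. (B n (t (Suc i)) \<omega> - B n (t i) \<omega>) / sqrt (t (Suc i) - t i) \<in> A n i}
    = (\<Prod>n<N. \<Prod>i<m. measure gauss (A n i))"
proof -
  define S where "S n = {\<omega>\<in>space M. \<forall>i<m. (B n (t (Suc i)) \<omega> - B n (t i) \<omega>) / sqrt (t (Suc i) - t i) \<in> A n i}" for n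
  have S: "S n \<in> sigma_sets (space M) (gen (BM_src n))" for n
  proof -
    have [measurable]: "B n t \<in> borel_measurable (src_algebra {BM_src n})" for t
      by (rule measurable_src_B) simp
    have [measurable]: "A n i \<in> sets borel" for i by (rule A)
    have "{\<omega>\<in>space (src_algebra {BM_src n}). \<forall>i<m. (B n (t (Suc i)) \<omega> - B n (t i) \<omega>) / sqrt (t (Suc i) - t i) \<in> A n i}
      \<in> sets (src_algebra {BM_src n})"
      by measurable
    then show ?thesis unfolding S_def sets_src_single by simp
  qed
  have "prob (\<Inter>s\<in>BM_src ` {..<N}. case_noise_src S (\<lambda>_. {}) (\<lambda>_. {}) s)
      = (\<Prod>s\<in>BM_src ` {..<N}. prob (case_noise_src S (\<lambda>_. {}) (\<lambda>_. {}) s))"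
    by (rule indep_setsD[OF indep_noise]) (use S N_pos in auto)
  also have "(\<Inter>s\<in>BM_src ` {..<N}. case_noise_src S (\<lambda>_. {}) (\<lambda>_. {}) s) =
      {\<omega>\<in>space M. \<forall>n<N. \<forall>i<m. (B n (t (Suc i)) \<omega> - B n (t i) \<omega>) / sqrt (t (Suc i) - t i) \<in> A n i}"
    using N_pos by (auto simp: S_def)
  also have "(\<Prod>s\<in>BM_src ` {..<N}. prob (case_noise_src S (\<lambda>_. {}) (\<lambda>_. {}) s)) = (\<Prod>n<N. prob (S n))"
    by (subst prod.reindex) (auto simp: inj_on_def)
  also have "\<dots> = (\<Prod>n<N. \<Prod>i<m. measure gauss (A n i))"
    unfolding S_def by (rule prod.cong[OF refl], rule single_path_increments) (use t A in auto)
  finally show ?thesis .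
qed

text \<open>The quantifier over \<open>t\<close> stands inside the almost sure event because the
  identity is applied at random times.\<close>

lemma AE_dlim_eq: "AE \<omega> in M. \<forall>n<N. \<forall>t\<ge>0. dlim (\<lambda>t. B n t \<omega>) t = B n t \<omega>"
proof -
  have "AE \<omega> in M. \<forall>n\<in>{..<N}. continuous_on {0..} (\<lambda>t. B n t \<omega>)"
    by (rule AE_finite_allI) (use BM in \<open>auto simp: std_BM_def elim: AE_mp\<close>)
  then show ?thesis by eventually_elim (auto intro: dlim_continuous)
qed

lemma AE_E_pos: "AE \<omega> in M. \<forall>i\<ge>1. 0 < E i \<omega>"
proof -
  have "AE \<omega> in M. 1 \<le> i \<longrightarrow> 0 < E i \<omega>" for i
  proof (cases "1 \<le> i")
    case True
    \<comment> \<open>The density is positive at 0 as well, so this point has to be discarded as a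
      null set.\<close>
    have "AE x in lborel. x \<noteq> (0::real)" by (rule AE_lborel_singleton)
    then have "AE x in lborel. 0 < exponential_density (real N) x \<longrightarrow> 0 < x"
      by eventually_elim (auto simp: exponential_density_def split: if_splits)
    then have "AE \<omega> in M. 0 < E i \<omega>"
      by (subst distributed_AE2[OF Exp[OF True]]) auto
    then show ?thesis by simp
  qed simp
  then show ?thesis by (simp add: AE_all_countable)
qed

section \<open>Joint law of the innovations\<close>

definition innov :: "nat \<Rightarrow> nat \<Rightarrow> 'a \<Rightarrow> real" where
  "innov i n \<omega> = (if n < N then
       (dlim (\<lambda>t. B n t \<omega>) (arrival i \<omega>) - dlim (\<lambda>t. B n t \<omega>) (arrival (i - 1) \<omega>)) / sqrt (E i \<omega>)
     else if n = N then E i \<omega> else real (K i \<omega>))"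

text \<open>Evaluating through \<open>dlim\<close> gives measurability on the whole space; agreement
  with \<open>B\<close> at the arrival times holds only almost surely.\<close>

lemma measurable_innov: "1 \<le> i \<Longrightarrow> innov i n \<in> borel_measurable M"
proof -
  assume i: "1 \<le> i"
  have [measurable]: "arrival j \<in> borel_measurable M" for j
    by (rule measurable_from_src(2)[OF measurable_src_arrival])
  have [measurable]: "E i \<in> borel_measurable M" "K i \<in> measurable M (count_space UNIV)"
    using i by (auto intro: measurable_E measurable_K)
  have [measurable]: "(\<lambda>\<omega>. dlim (\<lambda>t. B n t \<omega>) (arrival j \<omega>)) \<in> borel_measurable M" if "n < N" for j
    by (rule measurable_dlim[where S=M and Y="\<lambda>\<omega>. \<omega>"]) (use that in auto)
  show ?thesis unfolding innov_def by (cases "n < N") (simp_all cong: measurable_cong)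
qed

text \<open>The waiting times are integrated last: the Brownian paths and the jump clock live on two
  independent copies of the probability space, and for a frozen clock the normalised increments have
  a law that does not depend on it.\<close>
lemma gauss_innov_rectangle:
  assumes A: "\<And>n i. A n i \<in> sets borel" and S: "S \<in> sets (src_algebra jump_srcs)"
  shows "prob ({\<omega>\<in>space M. \<forall>n<N. \<forall>i<m. innov (Suc i) n \<omega> \<in> A n i} \<inter> S)
    = (\<Prod>n<N. \<Prod>i<m. measure gauss (A n i)) * prob S"
proof -
  let ?SB = "src_algebra bm_srcs" and ?SJ = "src_algebra jump_srcs"
  \<comment> \<open>The first coordinate supplies the paths and the second the clock; on the
    diagonal \<open>G n i\<close> is the innovation itself. The event \<open>S\<close> rides along
    on the second coordinate, so that the product formula also gives independence from waiting times
    and ranks.\<close>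
  define G where "G n i p = (dlim (\<lambda>t. B n t (fst p)) (arrival (Suc i) (snd p))
      - dlim (\<lambda>t. B n t (fst p)) (arrival i (snd p))) / sqrt (E (Suc i) (snd p))" for n i and p :: "'a \<times> 'a"
  define Rect where "Rect = {p\<in>space (?SB \<Otimes>\<^sub>M ?SJ). (\<forall>n<N. \<forall>i<m. G n i p \<in> A n i) \<and> snd p \<in> S}"
  define c where "c = (\<Prod>n<N. \<Prod>i<m. measure gauss (A n i))"
  have c: "0 \<le> c" unfolding c_def by (intro prod_nonneg) auto
  have [measurable]: "G n i \<in> borel_measurable (?SB \<Otimes>\<^sub>M ?SJ)" if "n < N" for n i
  proof -
    have [measurable]: "arrival j \<in> borel_measurable ?SJ" for j by (rule measurable_src_arrival)
    have [measurable]: "E (Suc i) \<in> borel_measurable ?SJ" by (rule measurable_src_E) auto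
    have [measurable]: "(\<lambda>p. dlim (\<lambda>t. B n t (fst p)) (arrival j (snd p))) \<in> borel_measurable (?SB \<Otimes>\<^sub>M ?SJ)" for j
      by (rule measurable_dlim[where S="?SB"]) (use that in \<open>auto intro: measurable_src_B\<close>)
    show ?thesis unfolding G_def by measurable
  qed
  note [measurable] = A S
  have Rect[measurable]: "Rect \<in> sets (?SB \<Otimes>\<^sub>M ?SJ)"
    unfolding Rect_def by measurable
  have idB[measurable]: "(\<lambda>\<omega>. \<omega>) \<in> measurable M ?SB"
    by (rule measurable_from_src(1)) simp
  have idJ[measurable]: "(\<lambda>\<omega>. \<omega>) \<in> measurable M ?SJ"
    by (rule measurable_from_src(2)) simp
  let ?PB = "distr M ?SB (\<lambda>\<omega>. \<omega>)" and ?PJ = "distr M ?SJ (\<lambda>\<omega>. \<omega>)"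
  interpret PB: prob_space ?PB by (rule prob_space_distr[OF idB])
  interpret PJ: prob_space ?PJ by (rule prob_space_distr[OF idJ])
  interpret pair_sigma_finite ?PB ?PJ ..
  have Sev: "S \<in> events" using S sets_src_subset by auto
  have "{\<omega>\<in>space M. \<forall>n<N. \<forall>i<m. innov (Suc i) n \<omega> \<in> A n i} \<inter> S = (\<lambda>\<omega>. (\<omega>, \<omega>)) -` Rect \<inter> space M"
  proof -
    have "innov (Suc i) n \<omega> = G n i (\<omega>, \<omega>)" if "n < N" for i n \<omega>
      using that by (simp add: innov_def G_def)
    then show ?thesis
      unfolding Rect_def using sets.sets_into_space[OF S] by (auto simp: space_pair_measure)
  qed
  then have "emeasure M ({\<omega>\<in>space M. \<forall>n<N. \<forall>i<m. innov (Suc i) n \<omega> \<in> A n i} \<inter> S)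
    = emeasure (distr M (?SB \<Otimes>\<^sub>M ?SJ) (\<lambda>\<omega>. (\<omega>, \<omega>))) Rect"
    by (simp add: emeasure_distr)
  also have "\<dots> = emeasure (?PB \<Otimes>\<^sub>M ?PJ) Rect"
    by (subst distr_diagonal_indep[OF indep_srcs]) auto
  also have "\<dots> = (\<integral>\<^sup>+\<omega>. emeasure ?PB ((\<lambda>x. (x, \<omega>)) -` Rect) \<partial>?PJ)"
    by (rule emeasure_pair_measure_alt2) simp
  also have "\<dots> = (\<integral>\<^sup>+\<omega>. emeasure ?PB ((\<lambda>x. (x, \<omega>)) -` Rect) \<partial>M)"
    by (rule nn_integral_distr[OF idJ]) (use measurable_emeasure_Pair2[of Rect] in simp)
  also have "\<dots> = (\<integral>\<^sup>+\<omega>. ennreal c * indicator S \<omega> \<partial>M)"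
  proof (rule nn_integral_cong_AE)
    show "AE \<omega> in M. emeasure ?PB ((\<lambda>x. (x, \<omega>)) -` Rect) = ennreal c * indicator S \<omega>"
      using AE_E_pos AE_space
    proof eventually_elim
      fix \<omega> assume pos: "\<forall>i\<ge>1. 0 < E i \<omega>" and w: "\<omega> \<in> space M"
      show "emeasure ?PB ((\<lambda>x. (x, \<omega>)) -` Rect) = ennreal c * indicator S \<omega>"
      proof (cases "\<omega> \<in> S")
        case False
        then have "(\<lambda>x. (x, \<omega>)) -` Rect = {}" by (auto simp: Rect_def)
        then show ?thesis using False by simp
      next
        case True
        define t where "t i = arrival i \<omega>" for i
        have t: "0 \<le> t 0" "t i < t (Suc i)" "t (Suc i) - t i = E (Suc i) \<omega>" for i
          using pos by (auto simp: t_def arrival_def jump_time_def)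
        have t_nonneg: "0 \<le> t i" for i
        proof (induction i)
          case (Suc i)
          then show ?case using t(2)[of i] by linarith
        qed (rule t(1))
        have meas: "(\<lambda>x. (x, \<omega>)) -` Rect \<in> sets ?SB"
          by (rule sets_Pair2[OF Rect])
        then have "emeasure ?PB ((\<lambda>x. (x, \<omega>)) -` Rect) = emeasure M ((\<lambda>x. (x, \<omega>)) -` Rect)"
          using sets.sets_into_space[OF meas] by (subst emeasure_distr) (auto simp: Int_absorb2)
        also have "\<dots> = emeasure M {x\<in>space M. \<forall>n<N. \<forall>i<m. (B n (t (Suc i)) x - B n (t i) x) / sqrt (t (Suc i) - t i) \<in> A n i}"
        proof (rule emeasure_eq_AE)
          show "AE x in M. (x \<in> (\<lambda>x. (x, \<omega>)) -` Rect) =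
            (x \<in> {x\<in>space M. \<forall>n<N. \<forall>i<m. (B n (t (Suc i)) x - B n (t i) x) / sqrt (t (Suc i) - t i) \<in> A n i})"
            using AE_dlim_eq AE_space
            by eventually_elim (use True w t_nonneg in \<open>auto simp: Rect_def G_def space_pair_measure t(3) simp flip: t_def\<close>)
          show "(\<lambda>x. (x, \<omega>)) -` Rect \<in> events" using meas sets_src_subset by auto
          show "{x\<in>space M. \<forall>n<N. \<forall>i<m. (B n (t (Suc i)) x - B n (t i) x) / sqrt (t (Suc i) - t i) \<in> A n i} \<in> events"
            by measurable
        qed
        also have "\<dots> = ennreal c"
          unfolding emeasure_eq_measure c_def by (subst all_path_increments) (use t A in auto)
        finally show ?thesis using True by simp
      qed
    qed
  qed
  also have "\<dots> = ennreal c * emeasure M S"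
    using Sev by (simp add: nn_integral_cmult)
  finally show ?thesis
    using c unfolding emeasure_eq_measure by (simp add: c_def[symmetric] ennreal_mult[symmetric])
qed

definition innov_law :: "nat \<Rightarrow> real measure" where
  "innov_law n = (if n < N then gauss
     else if n = N then density lborel (exponential_density (real N))
     else distr (measure_pmf (pmf_of_set {1..N})) borel real)"

lemma distr_innov:
  assumes i: "1 \<le> i"
  shows "distr M borel (innov i n) = innov_law n"
proof -
  consider "n < N" | "n = N" | "n > N" by linarith
  then show ?thesis
  proof cases
    case 1
    show ?thesis
    proof (rule measure_eqI)
      show "sets (distr M borel (innov i n)) = sets (innov_law n)" using 1 by (simp add: innov_law_def)
      fix X assume "X \<in> sets (distr M borel (innov i n))"
      then have X: "X \<in> sets borel" by simp
      \<comment> \<open>All sides of the rectangle are trivial except the one at \<open>n\<close>,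
        \<open>i\<close>. The index \<open>i'\<close> starts at 0 and belongs to the innovation
        \<open>Suc i'\<close>.\<close>
      define A where "A n' i' = (if n' = n \<and> Suc i' = i then X else UNIV)" for n' i'
      have "prob ({\<omega>\<in>space M. \<forall>n<N. \<forall>i'<i. innov (Suc i') n \<omega> \<in> A n i'} \<inter> space M)
         = (\<Prod>n<N. \<Prod>i'<i. measure gauss (A n i')) * prob (space M)"
        by (rule gauss_innov_rectangle) (use X sets.top[of "src_algebra jump_srcs"] in \<open>auto simp: A_def\<close>)
      also have "(\<Prod>n'<N. \<Prod>i'<i. measure gauss (A n' i')) = (\<Prod>n'<N. \<Prod>i'<i. if n' = n \<and> i' = i - 1 then measure gauss X else 1)"
        using i prob_space.prob_space[OF prob_space_gauss] by (intro prod.cong refl) (auto simp: A_def)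
      also have "\<dots> = (\<Prod>n'<N. if n' = n then measure gauss X else 1)"
        using i by (intro prod.cong refl) (auto simp: prod.delta)
      also have "\<dots> = measure gauss X" using 1 by (simp add: prod.delta)
      also have "{\<omega>\<in>space M. \<forall>n<N. \<forall>i'<i. innov (Suc i') n \<omega> \<in> A n i'} \<inter> space M = innov i n -` X \<inter> space M"
      proof (intro set_eqI iffI)
        fix \<omega> assume "\<omega> \<in> {\<omega>\<in>space M. \<forall>n<N. \<forall>i'<i. innov (Suc i') n \<omega> \<in> A n i'} \<inter> space M"
        then have w: "\<omega> \<in> space M" and all: "\<forall>n<N. \<forall>i'<i. innov (Suc i') n \<omega> \<in> A n i'" by blast+
        have "innov (Suc (i - 1)) n \<omega> \<in> A n (i - 1)" by (rule all[rule_format]) (use 1 i in auto)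
        then show "\<omega> \<in> innov i n -` X \<inter> space M" using i w by (simp add: A_def)
      next
        fix \<omega> assume "\<omega> \<in> innov i n -` X \<inter> space M"
        then have w: "\<omega> \<in> space M" "innov i n \<omega> \<in> X" by auto
        have "innov (Suc i') n' \<omega> \<in> A n' i'" for n' i'
          unfolding A_def using w(2) by (cases "n' = n \<and> Suc i' = i") auto
        then show "\<omega> \<in> {\<omega>\<in>space M. \<forall>n<N. \<forall>i'<i. innov (Suc i') n \<omega> \<in> A n i'} \<inter> space M"
          using w(1) by blast
      qed
      finally have "prob (innov i n -` X \<inter> space M) = measure gauss X" by (simp add: prob_space)
      then show "emeasure (distr M borel (innov i n)) X = emeasure (innov_law n) X"
        using 1 X measurable_innov[OF i] finite_measure.emeasure_eq_measure[OF prob_space.finite_measure[OF prob_space_gauss]]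
        by (simp add: emeasure_distr emeasure_eq_measure innov_law_def)
    qed
  next
    case 2
    have "distr M borel (innov i n) = distr M lborel (E i)"
      by (rule distr_cong) (auto simp: innov_def 2)
    then show ?thesis using distributed_distr_eq_density[OF Exp[OF i]] 2 by (simp add: innov_law_def)
  next
    case 3
    have "distr M borel (innov i n) = distr (distr M (count_space UNIV) (K i)) borel real"
      using 3 measurable_K[OF i] by (subst distr_distr) (auto intro!: distr_cong simp: innov_def)
    then show ?thesis using Unif[OF i] 3 by (simp add: innov_law_def)
  qed
qed

lemma prob_space_innov_law: "prob_space (innov_law n)"
  using prob_space_distr[OF measurable_innov[of 1 n]] distr_innov[of 1 n] by simp

lemma sets_innov_law[simp, measurable_cong]: "sets (innov_law n) = sets borel"
  by (simp add: innov_law_def)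

lemma prob_innov:
  "1 \<le> i \<Longrightarrow> X \<in> sets borel \<Longrightarrow> prob (innov i n -` X \<inter> space M) = measure (innov_law n) X"
  by (subst distr_innov[symmetric]) (auto simp: measure_distr measurable_innov)

text \<open>Each generating family contains the whole space, so over a finite index set only the
  product formula for the full intersection has to be checked. That intersection is a Gaussian
  rectangle intersected with an event \<open>S\<close> of waiting times and ranks, which is the
  shape of \<open>gauss_innov_rectangle\<close>; \<open>prob S\<close> factorises by the
  independence of the sources.\<close>

lemma indep_innov: "indep_vars (\<lambda>_. borel) (\<lambda>(i, n). innov i n) ({1..m} \<times> {..<N + 2})"
proof (cases "m = 0")
  case True
  then show ?thesis by (simp add: indep_vars_def2 indep_sets_def)
next
  case m: False
  let ?I = "{1..m} \<times> {..<N + 2}"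
  show ?thesis
    unfolding indep_vars_def2
  proof (intro conjI ballI)
    fix p assume "p \<in> ?I"
    then show "random_variable borel (case p of (i, n) \<Rightarrow> innov i n)"
      by (auto intro: measurable_innov)
  next
    show "indep_sets (\<lambda>p. {(case p of (i, n) \<Rightarrow> innov i n) -` A \<inter> space M | A. A \<in> sets borel}) ?I"
    proof (subst indep_sets_finite, goal_cases)
      case 1
      show ?case using m by auto
    next
      case 2
      show ?case by simp
    next
      case (3 p)
      then show ?case by (auto intro!: measurable_sets[OF measurable_innov])
    next
      case (4 p)
      then show ?case by (auto intro!: exI[of _ UNIV])
    next
      case 5
      show ?case
      proof
        fix F assume "F \<in> (\<Pi> p\<in>?I. {(case p of (i, n) \<Rightarrow> innov i n) -` A \<inter> space M | A. A \<in> sets borel})"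
        then have "\<forall>p\<in>?I. \<exists>A. A \<in> sets borel \<and> F p = (case p of (i, n) \<Rightarrow> innov i n) -` A \<inter> space M"
          unfolding Pi_iff mem_Collect_eq by blast
        from bchoice[OF this]
        obtain A0 where A0: "\<forall>p\<in>?I. A0 p \<in> sets borel \<and> F p = (case p of (i, n) \<Rightarrow> innov i n) -` A0 p \<inter> space M"
          by blast
        define A where "A p = (if p \<in> ?I then A0 p else UNIV)" for p
        have A: "A p \<in> sets borel" for p using A0 by (auto simp: A_def)
        have F: "F (i, n) = innov i n -` A (i, n) \<inter> space M" if "i \<in> {1..m}" "n < N + 2" for i n
          using A0 that by (auto simp: A_def)
        define SE where "SE i = E i -` A (i, N) \<inter> space M" for i
        define SK where "SK i = K i -` (real -` A (i, Suc N)) \<inter> space M" for i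
        define S where "S = (\<Inter>i\<in>{1..m}. SE i \<inter> SK i)"
        have SE: "SE i \<in> gen (E_src i)" and SK: "SK i \<in> gen (K_src i)" for i
          using A by (auto simp: SE_def SK_def noise_gen_def)
        have S: "S \<in> sets (src_algebra jump_srcs)"
          unfolding S_def using m
          by (intro sets.finite_INT sets.Int gen_in_src[OF _ SE] gen_in_src[OF _ SK]) auto
        have "(\<Inter>p\<in>?I. F p) = {\<omega>\<in>space M. \<forall>n<N. \<forall>i<m. innov (Suc i) n \<omega> \<in> A (Suc i, n)} \<inter> S"
        proof (intro set_eqI iffI)
          fix \<omega> assume w: "\<omega> \<in> (\<Inter>p\<in>?I. F p)"
          have all: "\<omega> \<in> space M \<and> innov i n \<omega> \<in> A (i, n)" if "i \<in> {1..m}" "n < N + 2" for i n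
            using w that F[OF that] by auto
          show "\<omega> \<in> {\<omega>\<in>space M. \<forall>n<N. \<forall>i<m. innov (Suc i) n \<omega> \<in> A (Suc i, n)} \<inter> S"
            using m all[of _ N] all[of _ "Suc N"] all[of "Suc _"] all[of 1 0]
            by (auto simp: S_def SE_def SK_def innov_def[of _ N] innov_def[of _ "Suc N"])
        next
          fix \<omega> assume w: "\<omega> \<in> {\<omega>\<in>space M. \<forall>n<N. \<forall>i<m. innov (Suc i) n \<omega> \<in> A (Suc i, n)} \<inter> S"
          have "\<omega> \<in> F (i, n)" if i: "i \<in> {1..m}" and n: "n < N + 2" for i n
          proof -
            obtain j where j: "i = Suc j" "j < m" using i by (cases i) auto
            consider "n < N" | "n = N" | "n = Suc N" using n by linarith
            then show ?thesis
              using w i j unfolding F[OF i n]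
              by cases (auto simp: S_def SE_def SK_def innov_def Suc_le_eq)
          qed
          then show "\<omega> \<in> (\<Inter>p\<in>?I. F p)" by auto
        qed
        then have "prob (\<Inter>p\<in>?I. F p) = (\<Prod>n<N. \<Prod>i<m. measure gauss (A (Suc i, n))) * prob S"
          using gauss_innov_rectangle[where A="\<lambda>n i. A (Suc i, n)", OF A S] by simp
        also have "(\<Prod>n<N. \<Prod>i<m. measure gauss (A (Suc i, n))) = (\<Prod>n<N. \<Prod>i=1..m. prob (F (i, n)))"
        proof (rule prod.cong[OF refl])
          fix n assume "n \<in> {..<N}"
          then have "(\<Prod>i=1..m. prob (F (i, n))) = (\<Prod>i=1..m. measure gauss (A (i, n)))"
            using A by (intro prod.cong refl) (auto simp: F prob_innov innov_law_def)
          also have "\<dots> = (\<Prod>i<m. measure gauss (A (Suc i, n)))"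
            by (rule prod.reindex_bij_witness[of _ Suc "\<lambda>i. i - 1"]) auto
          finally show "(\<Prod>i<m. measure gauss (A (Suc i, n))) = (\<Prod>i=1..m. prob (F (i, n)))" by simp
        qed
        also have "prob S = (\<Prod>i=1..m. prob (F (i, N))) * (\<Prod>i=1..m. prob (F (i, Suc N)))"
        proof -
          let ?J = "E_src ` {1..m} \<union> K_src ` {1..m}" and ?f = "case_noise_src (\<lambda>_. {}) SE SK"
          have "prob (\<Inter>s\<in>?J. ?f s) = (\<Prod>s\<in>?J. prob (?f s))"
            by (rule indep_setsD[OF indep_noise]) (use m SE SK in \<open>auto intro!: sigma_sets.Basic\<close>)
          also have "(\<Inter>s\<in>?J. ?f s) = S"
            by (simp add: S_def INT_Un INT_Int_distrib image_comp)
          also have "(\<Prod>s\<in>?J. prob (?f s)) = (\<Prod>s\<in>E_src ` {1..m}. prob (?f s)) * (\<Prod>s\<in>K_src ` {1..m}. prob (?f s))"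
            by (rule prod.union_disjoint) auto
          also have "(\<Prod>s\<in>E_src ` {1..m}. prob (?f s)) = (\<Prod>i=1..m. prob (SE i))"
            by (subst prod.reindex) (auto simp: inj_on_def)
          also have "(\<Prod>s\<in>K_src ` {1..m}. prob (?f s)) = (\<Prod>i=1..m. prob (SK i))"
            by (subst prod.reindex) (auto simp: inj_on_def)
          also have "(\<Prod>i=1..m. prob (SE i)) = (\<Prod>i=1..m. prob (F (i, N)))"
            by (intro prod.cong refl arg_cong[where f=prob]) (auto simp: F SE_def innov_def)
          also have "(\<Prod>i=1..m. prob (SK i)) = (\<Prod>i=1..m. prob (F (i, Suc N)))"
            by (intro prod.cong refl arg_cong[where f=prob]) (auto simp: F SK_def innov_def)
          finally show ?thesis .
        qed
        also have "(\<Prod>n<N. \<Prod>i=1..m. prob (F (i, n))) * ((\<Prod>i=1..m. prob (F (i, N))) * (\<Prod>i=1..m. prob (F (i, Suc N))))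
          = (\<Prod>n<N + 2. \<Prod>i=1..m. prob (F (i, n)))"
          by (simp add: numeral_2_eq_2 mult.assoc)
        also have "\<dots> = (\<Prod>i=1..m. \<Prod>n<N + 2. prob (F (i, n)))"
          by (rule prod.swap)
        also have "\<dots> = (\<Prod>p\<in>?I. prob (F p))"
          by (subst prod.cartesian_product) (simp add: case_prod_unfold)
        finally show "prob (\<Inter>p\<in>?I. F p) = (\<Prod>p\<in>?I. prob (F p))" .
      qed
    qed
  qed
qed

text \<open>Positive waiting times allow the normalisation to be undone; this identifies the
  increments used by the chain with the true Brownian ones.\<close>

lemma sqrt_innov:
  "AE \<omega> in M. \<forall>i. \<forall>n<N. sqrt (innov (Suc i) N \<omega>) * innov (Suc i) n \<omega>
     = B n (arrival (Suc i) \<omega>) \<omega> - B n (arrival i \<omega>) \<omega>"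
  using AE_dlim_eq AE_E_pos
proof eventually_elim
  fix \<omega> assume dl: "\<forall>n<N. \<forall>t\<ge>0. dlim (\<lambda>t. B n t \<omega>) t = B n t \<omega>" and pos: "\<forall>i\<ge>1. 0 < E i \<omega>"
  have nonneg: "0 \<le> arrival i \<omega>" for i
    unfolding arrival_def jump_time_def by (rule sum_nonneg) (use pos in \<open>auto intro: less_imp_le\<close>)
  show "\<forall>i. \<forall>n<N. sqrt (innov (Suc i) N \<omega>) * innov (Suc i) n \<omega>
     = B n (arrival (Suc i) \<omega>) \<omega> - B n (arrival i \<omega>) \<omega>"
  proof (intro allI impI)
    fix i n assume n: "n < N"
    show "sqrt (innov (Suc i) N \<omega>) * innov (Suc i) n \<omega> = B n (arrival (Suc i) \<omega>) \<omega> - B n (arrival i \<omega>) \<omega>"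
      using dl nonneg n pos[rule_format, of "Suc i"] by (simp add: innov_def)
  qed
qed

text \<open>The uniform law gives ranks in \<open>{1..N}\<close> almost surely, so the clamping in
  \<open>rank_of\<close> is invisible.\<close>

lemma AE_rank: "AE \<omega> in M. \<forall>i. rank_of N (innov (Suc i) (Suc N) \<omega>) = K (Suc i) \<omega>"
proof -
  have "AE \<omega> in M. K (Suc i) \<omega> \<in> {1..N}" for i
  proof -
    have "AE k in measure_pmf (pmf_of_set {1..N}). k \<in> {1..N}"
      using N_pos by (simp add: AE_measure_pmf_iff)
    then have "AE k in distr M (count_space UNIV) (K (Suc i)). k \<in> {1..N}"
      by (subst Unif) simp_all
    then show ?thesis
      by (subst (asm) AE_distr_iff) (auto intro: measurable_K)
  qed
  then have "AE \<omega> in M. \<forall>i. K (Suc i) \<omega> \<in> {1..N}" by (simp add: AE_all_countable)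
  then show ?thesis
    by eventually_elim (simp add: innov_def rank_of_def min_absorb2 max_absorb2)
qed

end

section \<open>The embedded Markov chain and its monotonicity\<close>

abbreviation state_space :: "nat \<Rightarrow> ((nat \<Rightarrow> real) \<times> real) measure" where
  "state_space N \<equiv> (\<Pi>\<^sub>M n\<in>{..<N}. borel) \<Otimes>\<^sub>M borel"

lemma measurable_min_label:
  assumes "0 < N"
  shows "min_label N \<in> measurable (\<Pi>\<^sub>M n\<in>{..<N}. borel) (count_space UNIV)"
proof (subst measurable_count_space_eq2_countable, intro conjI ballI)
  fix n :: nat
  let ?S = "\<Pi>\<^sub>M n\<in>{..<N}. (borel :: real measure)"
  show "min_label N -` {n} \<inter> space ?S \<in> sets ?S"
  proof (cases "n < N")
    case False
    then have "min_label N -` {n} \<inter> space ?S = {}" using min_label_props(1)[OF assms] by auto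
    then show ?thesis by simp
  next
    case True
    have [measurable]: "(\<lambda>z. z m) \<in> borel_measurable ?S" if "m < N" for m
      using that by (intro measurable_component_singleton) auto
    have eq: "min_label N -` {n} \<inter> space ?S =
        {z\<in>space ?S. (\<forall>m\<in>{..<N}. z n \<le> z m) \<and> (\<forall>l\<in>{..<n}. \<exists>m\<in>{..<N}. z m < z l)}"
    proof (rule set_eqI)
      fix z
      have "min_label N z = n \<longleftrightarrow> (\<forall>m\<in>{..<N}. z n \<le> z m) \<and> (\<forall>l\<in>{..<n}. \<exists>m\<in>{..<N}. z m < z l)"
        unfolding min_label_eq_iff[OF assms] using True by blast
      then show "z \<in> min_label N -` {n} \<inter> space ?S \<longleftrightarrow>
        z \<in> {z\<in>space ?S. (\<forall>m\<in>{..<N}. z n \<le> z m) \<and> (\<forall>l\<in>{..<n}. \<exists>m\<in>{..<N}. z m < z l)}"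
        by blast
    qed
    have 1: "{z\<in>space ?S. z n \<le> z m} \<in> sets ?S" if "m < N" for m
      using True that by measurable
    have 2: "{z\<in>space ?S. z m < z l} \<in> sets ?S" if "m < N" "l < N" for m l
      using that by measurable
    show ?thesis
      unfolding eq
      by (intro sets.sets_Collect_conj sets.sets_Collect_finite_All sets.sets_Collect_finite_Ex)
         (use True in \<open>auto intro!: 1 2\<close>)
  qed
qed auto

lemma measurable_order_stat:
  assumes k: "1 \<le> k" "k \<le> N"
  shows "(\<lambda>z. order_stat N z k) \<in> borel_measurable (\<Pi>\<^sub>M n\<in>{..<N}. borel)"
proof (rule borel_measurable_iff_le[THEN iffD2], intro allI)
  fix c :: real
  let ?S = "\<Pi>\<^sub>M n\<in>{..<N}. (borel :: real measure)"
  have [measurable]: "(\<lambda>z. z m) \<in> borel_measurable ?S" if "m \<in> {..<N}" for m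
    using that by (intro measurable_component_singleton) auto
  \<comment> \<open>The count becomes a sum of indicator functions, which is visibly
    measurable.\<close>
  have "order_stat N z k \<le> c \<longleftrightarrow> real k \<le> (\<Sum>n\<in>{..<N}. if z n \<le> c then 1 else 0)" for z
  proof -
    have "(\<Sum>n\<in>{..<N}. if z n \<le> c then 1 else 0 :: real) = real (card {n\<in>{..<N}. z n \<le> c})"
      by (subst sum.inter_filter[symmetric]) auto
    then show ?thesis using order_stat_le_iff[OF k, of z c] by simp
  qed
  then have "{z\<in>space ?S. order_stat N z k \<le> c} = {z\<in>space ?S. real k \<le> (\<Sum>n\<in>{..<N}. if z n \<le> c then 1 else 0)}"
    by simp
  also have "\<dots> \<in> sets ?S" by measurable
  finally show "{z\<in>space ?S. order_stat N z k \<le> c} \<in> sets ?S" .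
qed

lemma measurable_cull:
  assumes N: "0 < N" and k: "1 \<le> k" "k \<le> N"
  shows "cull N k \<in> measurable (\<Pi>\<^sub>M n\<in>{..<N}. borel) (\<Pi>\<^sub>M n\<in>{..<N}. borel)"
  unfolding cull_def
proof (rule measurable_restrict)
  fix n assume "n \<in> {..<N}"
  note [measurable] = measurable_min_label[OF N] measurable_order_stat[OF k]
    measurable_component_singleton[OF \<open>n \<in> {..<N}\<close>]
  show "(\<lambda>x. if n = min_label N x then order_stat N x k else x n) \<in> borel_measurable (\<Pi>\<^sub>M n\<in>{..<N}. borel)"
    by measurable
qed

lemma measurable_nstep:
  assumes N: "0 < N" and S: "sets S = sets (\<Pi>\<^sub>M n\<in>{..<N + 2}. (borel :: real measure))"
  shows "(\<lambda>p. nstep N \<mu> (fst p) (snd p)) \<in> measurable (S \<Otimes>\<^sub>M state_space N) (state_space N)"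
proof -
  have comp: "(\<lambda>p. fst p n) \<in> borel_measurable (S \<Otimes>\<^sub>M state_space N)" if "n < N + 2" for n
  proof -
    have "(\<lambda>u. u n) \<in> borel_measurable (\<Pi>\<^sub>M n\<in>{..<N + 2}. (borel :: real measure))"
      using that by (intro measurable_component_singleton) auto
    then have "(\<lambda>u. u n) \<in> borel_measurable S" using S by (simp cong: measurable_cong_sets)
    from measurable_compose[OF measurable_fst this] show ?thesis .
  qed
  have [measurable]: "(\<lambda>p. fst p N) \<in> borel_measurable (S \<Otimes>\<^sub>M state_space N)"
    "(\<lambda>p. fst p (Suc N)) \<in> borel_measurable (S \<Otimes>\<^sub>M state_space N)"
    by (rule comp; simp)+
  have pre: "(\<lambda>p. step_pre N (fst p) (fst (snd p))) \<in> measurable (S \<Otimes>\<^sub>M state_space N) (\<Pi>\<^sub>M n\<in>{..<N}. borel)"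
    unfolding step_pre_def
  proof (rule measurable_restrict)
    fix n assume n: "n \<in> {..<N}"
    have [measurable]: "(\<lambda>p. fst (snd p) n) \<in> borel_measurable (S \<Otimes>\<^sub>M state_space N)"
      by (rule measurable_compose[OF _ measurable_component_singleton[OF n]]) measurable
    have [measurable]: "(\<lambda>p. fst p n) \<in> borel_measurable (S \<Otimes>\<^sub>M state_space N)"
      using n by (intro comp) auto
    show "(\<lambda>p. fst (snd p) n + sqrt (fst p N) * fst p n) \<in> borel_measurable (S \<Otimes>\<^sub>M state_space N)"
      by measurable
  qed
  \<comment> \<open>The rank takes countably many values, so each can be treated as fixed; clamping
    every \<open>k\<close> keeps it in the range where \<open>cull\<close> is known to be
    measurable.\<close>
  have "(\<lambda>p. cull N (max 1 (min N (nat \<lfloor>fst p (Suc N)\<rfloor>))) (step_pre N (fst p) (fst (snd p))))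
      \<in> measurable (S \<Otimes>\<^sub>M state_space N) (\<Pi>\<^sub>M n\<in>{..<N}. borel)"
    by (rule measurable_compose_countable[where f="\<lambda>k p. cull N (max 1 (min N k)) (step_pre N (fst p) (fst (snd p)))"])
       (use N in \<open>auto intro!: measurable_compose[OF pre measurable_cull]\<close>)
  then have [measurable]: "(\<lambda>p. cull N (rank_of N (fst p (Suc N))) (step_pre N (fst p) (fst (snd p))))
      \<in> measurable (S \<Otimes>\<^sub>M state_space N) (\<Pi>\<^sub>M n\<in>{..<N}. borel)"
    by (simp add: rank_of_def)
  show ?thesis unfolding nstep_def by measurable
qed

lemma nstep_in_space: "nstep N \<mu> u z \<in> space (state_space N)"
  by (auto simp: nstep_def cull_def space_pair_measure space_PiM)

lemma measurable_height: "0 < N \<Longrightarrow> height N \<in> borel_measurable (state_space N)"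
  unfolding height_def
proof (intro borel_measurable_diff)
  assume "0 < N"
  have "(\<lambda>z. Min ((\<lambda>n. fst z n) ` {..<N})) \<in> borel_measurable (state_space N)"
  proof (rule borel_measurable_Min)
    fix n assume "n \<in> {..<N}"
    then show "(\<lambda>z. fst z n) \<in> borel_measurable (state_space N)"
      by (intro measurable_compose[OF measurable_fst measurable_component_singleton]) auto
  qed simp
  then show "(\<lambda>z. Min (fst z ` {..<N})) \<in> borel_measurable (state_space N)" by simp
qed measurable

lemma nstep_restrict: "nstep N \<mu> (\<lambda>n\<in>{..<N + 2}. u n) z = nstep N \<mu> u z"
  unfolding nstep_def step_pre_def by (auto intro!: arg_cong[where f="cull N _"])

text \<open>The motion of the particles ignores the reference level. Hence the chain can be
  restarted with its level raised to the current minimum, that is, at height 0.\<close>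

lemma nstep_shift_level: "nstep N \<mu> u (fst z, snd z + h) = (fst (nstep N \<mu> u z), snd (nstep N \<mu> u z) + h)"
  by (simp add: nstep_def)

section \<open>The filtration of the innovations\<close>

context nbbm_noise
begin

definition innov_gen :: "nat \<times> nat \<Rightarrow> 'a set set" where
  "innov_gen p = {(case p of (i, n) \<Rightarrow> innov i n) -` A \<inter> space M | A. A \<in> sets borel}"

definition innov_algebra :: "nat set \<Rightarrow> 'a measure" where
  "innov_algebra I = sigma (space M) (\<Union>p\<in>I \<times> {..<N + 2}. innov_gen p)"

abbreviation filt :: "nat \<Rightarrow> 'a measure" where "filt i \<equiv> innov_algebra {1..i}"

definition innov_vec :: "nat \<Rightarrow> 'a \<Rightarrow> nat \<Rightarrow> real" where
  "innov_vec i \<omega> = (\<lambda>n\<in>{..<N + 2}. innov i n \<omega>)"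

definition innov_prod :: "(nat \<Rightarrow> real) measure" where
  "innov_prod = (\<Pi>\<^sub>M n\<in>{..<N + 2}. innov_law n)"

lemma innov_gen_subset: "(\<Union>p\<in>P. innov_gen p) \<subseteq> Pow (space M)"
  by (auto simp: innov_gen_def)

lemma space_innov_algebra[simp]: "space (innov_algebra I) = space M"
  by (simp add: innov_algebra_def space_measure_of[OF innov_gen_subset])

lemma sets_innov_algebra: "sets (innov_algebra I) = sigma_sets (space M) (\<Union>p\<in>I \<times> {..<N + 2}. innov_gen p)"
  by (simp add: innov_algebra_def sets_measure_of[OF innov_gen_subset])

lemma measurable_innov_algebra:
  assumes "i \<in> I" "n < N + 2"
  shows "innov i n \<in> borel_measurable (innov_algebra I)"
proof (rule measurableI)
  fix A :: "real set" assume "A \<in> sets borel"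
  then have "innov i n -` A \<inter> space M \<in> innov_gen (i, n)" by (auto simp: innov_gen_def)
  then show "innov i n -` A \<inter> space (innov_algebra I) \<in> sets (innov_algebra I)"
    using assms unfolding sets_innov_algebra by (auto intro!: sigma_sets.Basic)
qed simp

lemma sets_innov_algebra_mono: "I \<subseteq> I' \<Longrightarrow> sets (innov_algebra I) \<subseteq> sets (innov_algebra I')"
  unfolding sets_innov_algebra by (rule sigma_sets_mono', rule UN_mono) auto

lemma measurable_innov_algebra_mono:
  "I \<subseteq> I' \<Longrightarrow> f \<in> measurable (innov_algebra I) S \<Longrightarrow> f \<in> measurable (innov_algebra I') S"
  using sets_innov_algebra_mono[of I I'] by (auto simp: measurable_def)

lemma sets_filt_events: "sets (filt i) \<subseteq> events"
  unfolding sets_innov_algebra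
  by (rule sets.sigma_sets_subset) (auto simp: innov_gen_def intro!: measurable_sets[OF measurable_innov])

lemma measurable_filt: "f \<in> measurable (filt i) S \<Longrightarrow> f \<in> measurable M S"
  using sets_filt_events[of i] by (auto simp: measurable_def)

lemma sets_innov_prod: "sets innov_prod = sets (\<Pi>\<^sub>M n\<in>{..<N + 2}. (borel :: real measure))"
  unfolding innov_prod_def by (rule sets_PiM_cong) auto

lemma prob_space_innov_prod: "prob_space innov_prod"
  unfolding innov_prod_def by (rule prob_space_PiM) (rule prob_space_innov_law)

lemma measurable_innov_vec: "i \<in> I \<Longrightarrow> innov_vec i \<in> measurable (innov_algebra I) innov_prod"
proof -
  assume "i \<in> I"
  then have "innov_vec i \<in> measurable (innov_algebra I) (\<Pi>\<^sub>M n\<in>{..<N + 2}. (borel :: real measure))"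
    unfolding innov_vec_def by (intro measurable_restrict measurable_innov_algebra) auto
  then show ?thesis using sets_innov_prod by (simp cong: measurable_cong_sets)
qed

lemma distr_innov_vec:
  assumes i: "1 \<le> i"
  shows "distr M innov_prod (innov_vec i) = innov_prod"
proof -
  have "indep_vars (\<lambda>_. borel) (\<lambda>p. case p of (i, n) \<Rightarrow> innov i n) (Pair i ` {..<N + 2})"
    by (rule indep_vars_subset[OF indep_innov[of i]]) (use i in auto)
  from indep_vars_inj_reindex[OF _ this]
  have "indep_vars (\<lambda>_. borel) (innov i) {..<N + 2}" by (simp add: inj_on_def)
  then have "distr M (\<Pi>\<^sub>M n\<in>{..<N + 2}. borel) (\<lambda>\<omega>. \<lambda>n\<in>{..<N + 2}. innov i n \<omega>)
      = (\<Pi>\<^sub>M n\<in>{..<N + 2}. distr M borel (innov i n))"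
    by (subst (asm) indep_vars_iff_distr_eq_PiM') (auto intro!: measurable_innov[OF i] simp: lessThan_empty_iff)
  also have "\<dots> = innov_prod"
    unfolding innov_prod_def by (rule PiM_cong) (auto simp: distr_innov[OF i])
  also have "distr M (\<Pi>\<^sub>M n\<in>{..<N + 2}. borel) (\<lambda>\<omega>. \<lambda>n\<in>{..<N + 2}. innov i n \<omega>) = distr M innov_prod (innov_vec i)"
    by (rule distr_cong) (auto simp: sets_innov_prod innov_vec_def)
  finally show ?thesis .
qed

lemma indep_filt_next: "indep_set (sets (filt i)) (sets (innov_algebra {Suc i}))"
proof -
  let ?I = "case_bool {1..i} {Suc i}"
  have "indep_sets (\<lambda>j. sigma_sets (space M) (\<Union>p\<in>?I j \<times> {..<N + 2}. innov_gen p)) UNIV"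
  proof (rule indep_sets_collect_sigma)
    have "(\<Union>j. ?I j \<times> {..<N + 2}) = {1..Suc i} \<times> {..<N + 2}"
      by (auto simp: UNIV_bool)
    then show "indep_sets innov_gen (\<Union>j. ?I j \<times> {..<N + 2})"
      using indep_innov[of "Suc i"] unfolding indep_vars_def2 innov_gen_def by simp
    show "disjoint_family (\<lambda>j. ?I j \<times> {..<N + 2})"
      by (auto simp: disjoint_family_on_def split: bool.splits)
    fix p :: "nat \<times> nat"
    show "Int_stable (innov_gen p)"
    proof (rule Int_stableI)
      fix a b assume "a \<in> innov_gen p" "b \<in> innov_gen p"
      then obtain A A' where *: "A \<in> sets borel" "A' \<in> sets borel"
          "a = (case p of (i, n) \<Rightarrow> innov i n) -` A \<inter> space M" "b = (case p of (i, n) \<Rightarrow> innov i n) -` A' \<inter> space M"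
        unfolding innov_gen_def by blast
      then have "a \<inter> b = (case p of (i, n) \<Rightarrow> innov i n) -` (A \<inter> A') \<inter> space M" by auto
      then show "a \<inter> b \<in> innov_gen p" unfolding innov_gen_def using * by blast
    qed
  qed
  then show ?thesis
    unfolding indep_set_def sets_innov_algebra by (rule indep_sets_mono_sets) (auto split: bool.split)
qed

text \<open>Freezing: the next innovation is integrated out while the past is held fixed. By
  independence the pair of past and next innovation has a product law, and nonnegativity of
  \<open>h\<close> is all that Tonelli's theorem asks for.\<close>

lemma nn_integral_innov_vec:
  assumes h: "h \<in> borel_measurable (filt i \<Otimes>\<^sub>M innov_prod)"
  shows "(\<integral>\<^sup>+\<omega>. h (\<omega>, innov_vec (Suc i) \<omega>) \<partial>M) = (\<integral>\<^sup>+\<omega>. (\<integral>\<^sup>+u. h (\<omega>, u) \<partial>innov_prod) \<partial>M)"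
proof -
  let ?F = "filt i" and ?G = "innov_algebra {Suc i}"
  have vec: "innov_vec (Suc i) \<in> measurable ?G innov_prod"
    by (rule measurable_innov_vec) simp
  have idF: "(\<lambda>\<omega>. \<omega>) \<in> measurable M ?F"
    by (rule measurable_filt[of _ i]) simp
  have "(\<lambda>\<omega>. \<omega>) \<in> measurable (filt (Suc i)) ?G"
    by (rule measurable_innov_algebra_mono[of "{Suc i}"]) auto
  then have idG: "(\<lambda>\<omega>. \<omega>) \<in> measurable M ?G" by (rule measurable_filt)
  interpret G: prob_space "distr M ?G (\<lambda>\<omega>. \<omega>)" by (rule prob_space_distr[OF idG])
  interpret Q: prob_space innov_prod by (rule prob_space_innov_prod)
  let ?h = "\<lambda>p. h (fst p, innov_vec (Suc i) (snd p))"
  have h': "?h \<in> borel_measurable (?F \<Otimes>\<^sub>M ?G)"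
    using h vec by measurable
  have vecM: "innov_vec (Suc i) \<in> measurable M innov_prod"
    using measurable_compose[OF idG vec] .
  have inner: "(\<integral>\<^sup>+x. h (\<omega>, innov_vec (Suc i) x) \<partial>distr M ?G (\<lambda>\<omega>. \<omega>)) = (\<integral>\<^sup>+u. h (\<omega>, u) \<partial>innov_prod)"
    if w: "\<omega> \<in> space M" for \<omega>
  proof -
    have hw: "(\<lambda>u. h (\<omega>, u)) \<in> borel_measurable innov_prod"
      using measurable_compose[OF measurable_Pair1'[of \<omega> ?F innov_prod] h] w by simp
    have "(\<integral>\<^sup>+u. h (\<omega>, u) \<partial>innov_prod) = (\<integral>\<^sup>+u. h (\<omega>, u) \<partial>distr M innov_prod (innov_vec (Suc i)))"
      by (simp add: distr_innov_vec)
    also have "\<dots> = (\<integral>\<^sup>+x. h (\<omega>, innov_vec (Suc i) x) \<partial>M)"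
      by (rule nn_integral_distr[OF vecM]) (use hw in simp)
    also have "\<dots> = (\<integral>\<^sup>+x. h (\<omega>, innov_vec (Suc i) x) \<partial>distr M ?G (\<lambda>\<omega>. \<omega>))"
      by (rule nn_integral_distr[OF idG, symmetric]) (use measurable_compose[OF vec hw] in simp)
    finally show ?thesis by simp
  qed
  have "(\<integral>\<^sup>+\<omega>. h (\<omega>, innov_vec (Suc i) \<omega>) \<partial>M) = (\<integral>\<^sup>+\<omega>. ?h (\<omega>, \<omega>) \<partial>M)" by simp
  also have "\<dots> = (\<integral>\<^sup>+p. ?h p \<partial>distr M (?F \<Otimes>\<^sub>M ?G) (\<lambda>\<omega>. (\<omega>, \<omega>)))"
    by (rule nn_integral_distr[OF measurable_Pair[OF idF idG], symmetric]) (use h' in simp)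
  also have "\<dots> = (\<integral>\<^sup>+p. ?h p \<partial>(distr M ?F (\<lambda>\<omega>. \<omega>) \<Otimes>\<^sub>M distr M ?G (\<lambda>\<omega>. \<omega>)))"
    by (subst distr_diagonal_indep[OF indep_filt_next]) auto
  also have "\<dots> = (\<integral>\<^sup>+\<omega>. (\<integral>\<^sup>+x. ?h (\<omega>, x) \<partial>distr M ?G (\<lambda>\<omega>. \<omega>)) \<partial>distr M ?F (\<lambda>\<omega>. \<omega>))"
    by (rule G.nn_integral_fst[symmetric]) (use h' in \<open>simp cong: measurable_cong_sets sets_pair_measure_cong\<close>)
  also have "\<dots> = (\<integral>\<^sup>+\<omega>. (\<integral>\<^sup>+u. h (\<omega>, u) \<partial>innov_prod) \<partial>distr M ?F (\<lambda>\<omega>. \<omega>))"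
    by (rule nn_integral_cong) (simp add: inner)
  also have "\<dots> = (\<integral>\<^sup>+\<omega>. (\<integral>\<^sup>+u. h (\<omega>, u) \<partial>innov_prod) \<partial>M)"
    by (rule nn_integral_distr[OF idF]) (use Q.borel_measurable_nn_integral_fst[OF h] in simp)
  finally show ?thesis .
qed

section \<open>The transition operator, its monotonicity and the Markov property\<close>

definition kern :: "real \<Rightarrow> ((nat \<Rightarrow> real) \<times> real \<Rightarrow> ennreal) \<Rightarrow> (nat \<Rightarrow> real) \<times> real \<Rightarrow> ennreal" where
  "kern \<mu> g z = (\<integral>\<^sup>+u. g (nstep N \<mu> u z) \<partial>innov_prod)"

lemma measurable_kern:
  assumes "g \<in> borel_measurable (state_space N)"
  shows "kern \<mu> g \<in> borel_measurable (state_space N)"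
proof -
  interpret Q: prob_space innov_prod by (rule prob_space_innov_prod)
  have swap: "(\<lambda>p. (snd p, fst p)) \<in> measurable (state_space N \<Otimes>\<^sub>M innov_prod) (innov_prod \<Otimes>\<^sub>M state_space N)"
    by measurable
  have "(\<lambda>p. g (nstep N \<mu> (snd p) (fst p))) \<in> borel_measurable (state_space N \<Otimes>\<^sub>M innov_prod)"
    using measurable_compose[OF swap measurable_compose[OF measurable_nstep[OF N_pos sets_innov_prod] assms]]
    by simp
  from Q.borel_measurable_nn_integral_fst[OF this] show ?thesis unfolding kern_def by simp
qed

lemma measurable_kern_funpow:
  "g \<in> borel_measurable (state_space N) \<Longrightarrow> (kern \<mu> ^^ L) g \<in> borel_measurable (state_space N)"
  by (induction L) (auto intro: measurable_kern)

text \<open>Decreasing functions are the relevant class because the deficit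
  \<open>C - min C (height N z)\<close> decreases as the configuration rises.\<close>

definition antitone :: "((nat \<Rightarrow> real) \<times> real \<Rightarrow> ennreal) \<Rightarrow> bool" where
  "antitone g \<longleftrightarrow> (\<forall>z\<in>space (state_space N). \<forall>w\<in>space (state_space N). dominated N z w \<longrightarrow> g w \<le> g z)"

text \<open>Only the Gaussian coordinates share a law, but \<open>p\<close> fixes the coordinates of
  the waiting time and the rank, so relabelling leaves every factor of the product
  unchanged.\<close>

lemma distr_innov_prod_permute:
  assumes p: "p permutes {..<N}"
  shows "distr innov_prod innov_prod (\<lambda>u. \<lambda>n\<in>{..<N + 2}. u (p n)) = innov_prod"
proof -
  have pp: "p permutes {..<N + 2}" using p by (rule permutes_subset) auto
  have p': "inj_on p {..<N + 2}" "p \<in> {..<N + 2} \<rightarrow> {..<N + 2}"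
    using permutes_inj_on[OF pp] permutes_in_image[OF pp] by auto
  have law: "innov_law (p n) = innov_law n" for n
  proof (cases "n < N")
    case True
    then show ?thesis using permutes_in_image[OF p, of n] by (simp add: innov_law_def)
  next
    case False
    then show ?thesis using p by (simp add: permutes_def)
  qed
  show ?thesis
    using distr_PiM_reindex[of "{..<N + 2}" innov_law p "{..<N + 2}", OF prob_space_innov_law p']
    unfolding innov_prod_def law .
qed

text \<open>Permuting the Gaussian innovations does not change their law, so two configurations that are
  ordered only up to a relabelling can be driven by relabelled innovations.\<close>
lemma antitone_kern:
  assumes g: "g \<in> borel_measurable (state_space N)" "antitone g"
  shows "antitone (kern \<mu> g)"
  unfolding antitone_def
proof (intro ballI impI)
  fix z w assume sp: "z \<in> space (state_space N)" "w \<in> space (state_space N)" and "dominated N z w"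
  then obtain p where p: "p permutes {..<N}" and le: "\<forall>n<N. fst z n - snd z \<le> fst w (p n) - snd w"
    unfolding dominated_def by auto
  let ?T = "\<lambda>u. \<lambda>n\<in>{..<N + 2}. u (inv p n) :: real"
  have T: "?T \<in> measurable innov_prod innov_prod"
  proof -
    have "?T \<in> measurable (\<Pi>\<^sub>M n\<in>{..<N + 2}. borel) (\<Pi>\<^sub>M n\<in>{..<N + 2}. borel)"
    proof (rule measurable_restrict)
      fix n assume n: "n \<in> {..<N + 2}"
      have "inv p permutes {..<N + 2}" using permutes_inv[OF p] by (rule permutes_subset) auto
      from permutes_in_image[OF this] n have "inv p n \<in> {..<N + 2}" by simp
      then show "(\<lambda>u. u (inv p n)) \<in> borel_measurable (\<Pi>\<^sub>M n\<in>{..<N + 2}. borel)"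
        by (rule measurable_component_singleton)
    qed
    then show ?thesis using sets_innov_prod by (simp cong: measurable_cong_sets)
  qed
  have meas: "(\<lambda>u. g (nstep N \<mu> u w)) \<in> borel_measurable innov_prod"
  proof -
    have "(\<lambda>u. (u, w)) \<in> measurable innov_prod (innov_prod \<Otimes>\<^sub>M state_space N)"
      using sp(2) by (rule measurable_Pair2')
    from measurable_compose[OF this measurable_compose[OF measurable_nstep[OF N_pos sets_innov_prod] g(1)]]
    show ?thesis by simp
  qed
  have "kern \<mu> g w = (\<integral>\<^sup>+u. g (nstep N \<mu> u w) \<partial>distr innov_prod innov_prod ?T)"
    unfolding distr_innov_prod_permute[OF permutes_inv[OF p]] kern_def ..
  also have "\<dots> = (\<integral>\<^sup>+u. g (nstep N \<mu> (?T u) w) \<partial>innov_prod)"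
    by (rule nn_integral_distr[OF T]) (use meas in simp)
  also have "\<dots> \<le> kern \<mu> g z"
    unfolding kern_def
  proof (rule nn_integral_mono)
    fix u
    show "g (nstep N \<mu> (?T u) w) \<le> g (nstep N \<mu> u z)"
      by (rule g(2)[unfolded antitone_def, rule_format, OF nstep_in_space nstep_in_space])
         (rule nstep_dominated[OF N_pos p], use le in simp)
  qed
  finally show "kern \<mu> g w \<le> kern \<mu> g z" .
qed

lemma antitone_kern_funpow:
  "g \<in> borel_measurable (state_space N) \<Longrightarrow> antitone g \<Longrightarrow> antitone ((kern \<mu> ^^ L) g)"
  by (induction L) (auto intro: antitone_kern measurable_kern_funpow)

text \<open>Each induction step peels off the last jump, replacing \<open>g\<close> by
  \<open>kern \<mu> g\<close>; the indicator of the past event \<open>A\<close> passes through. The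
  process \<open>Y\<close> may start from any state known at time \<open>i\<close>, which is needed
  because the lemma is applied to the chain with a shifted level.\<close>

lemma markov_kern:
  assumes g: "g \<in> borel_measurable (state_space N)" and A: "A \<in> sets (filt i)"
    and Y0: "Y 0 \<in> measurable (filt i) (state_space N)"
    and YS: "\<And>l \<omega>. Y (Suc l) \<omega> = nstep N \<mu> (innov_vec (Suc (i + l)) \<omega>) (Y l \<omega>)"
  shows "(\<integral>\<^sup>+\<omega>. g (Y L \<omega>) * indicator A \<omega> \<partial>M) = (\<integral>\<^sup>+\<omega>. (kern \<mu> ^^ L) g (Y 0 \<omega>) * indicator A \<omega> \<partial>M)"
  using g
proof (induction L arbitrary: g)
  case (Suc L)
  have Y: "Y l \<in> measurable (filt (i + l)) (state_space N)" for l
  proof (induction l)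
    case (Suc l)
    have 1: "Y l \<in> measurable (filt (i + Suc l)) (state_space N)"
      by (rule measurable_innov_algebra_mono[OF _ Suc]) auto
    have 2: "innov_vec (Suc (i + l)) \<in> measurable (filt (i + Suc l)) innov_prod"
      by (rule measurable_innov_vec) auto
    have "(\<lambda>\<omega>. nstep N \<mu> (innov_vec (Suc (i + l)) \<omega>) (Y l \<omega>)) \<in> measurable (filt (i + Suc l)) (state_space N)"
      using measurable_compose[OF measurable_Pair[OF 2 1] measurable_nstep[OF N_pos sets_innov_prod]] by simp
    then show ?case by (simp add: YS[abs_def, symmetric] flip: YS)
  qed (use Y0 in simp)
  have A': "A \<in> sets (filt (i + L))" using A sets_innov_algebra_mono[of "{1..i}" "{1..i + L}"] by auto
  let ?h = "\<lambda>p. g (nstep N \<mu> (snd p) (Y L (fst p))) * indicator A (fst p)"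
  have "(\<lambda>p. (snd p, Y L (fst p))) \<in> measurable (filt (i + L) \<Otimes>\<^sub>M innov_prod) (innov_prod \<Otimes>\<^sub>M state_space N)"
    using Y[of L] by measurable
  from measurable_compose[OF this measurable_compose[OF measurable_nstep[OF N_pos sets_innov_prod] Suc.prems]]
  have h1: "(\<lambda>p. g (nstep N \<mu> (snd p) (Y L (fst p)))) \<in> borel_measurable (filt (i + L) \<Otimes>\<^sub>M innov_prod)" by simp
  have h: "?h \<in> borel_measurable (filt (i + L) \<Otimes>\<^sub>M innov_prod)"
    using h1 A' by measurable
  have "(\<integral>\<^sup>+\<omega>. g (Y (Suc L) \<omega>) * indicator A \<omega> \<partial>M) = (\<integral>\<^sup>+\<omega>. ?h (\<omega>, innov_vec (Suc (i + L)) \<omega>) \<partial>M)"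
    by (simp add: YS)
  also have "\<dots> = (\<integral>\<^sup>+\<omega>. (\<integral>\<^sup>+u. ?h (\<omega>, u) \<partial>innov_prod) \<partial>M)"
    by (rule nn_integral_innov_vec[OF h])
  also have "\<dots> = (\<integral>\<^sup>+\<omega>. kern \<mu> g (Y L \<omega>) * indicator A \<omega> \<partial>M)"
    by (rule nn_integral_cong) (simp add: kern_def indicator_def)
  also have "\<dots> = (\<integral>\<^sup>+\<omega>. (kern \<mu> ^^ L) (kern \<mu> g) (Y 0 \<omega>) * indicator A \<omega> \<partial>M)"
    by (rule Suc.IH) (rule measurable_kern[OF Suc.prems])
  finally show ?case by (simp add: funpow_swap1)
qed simp

section \<open>The chain started at the origin and its block increments\<close>

definition chain :: "real \<Rightarrow> nat \<Rightarrow> 'a \<Rightarrow> (nat \<Rightarrow> real) \<times> real" where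
  "chain \<mu> i \<omega> = nchain N \<mu> (\<lambda>j n. innov j n \<omega>) i"

lemma chain_Suc: "chain \<mu> (Suc i) \<omega> = nstep N \<mu> (innov_vec (Suc i) \<omega>) (chain \<mu> i \<omega>)"
  unfolding chain_def innov_vec_def by (subst nstep_restrict) simp

lemma chain_0: "chain \<mu> 0 \<omega> = (\<lambda>n\<in>{..<N}. 0, 0)"
  by (simp add: chain_def)

lemma chain_0_in_space: "(\<lambda>n\<in>{..<N}. 0, 0) \<in> space (state_space N)"
  by (auto simp: space_pair_measure space_PiM)

lemma measurable_chain: "chain \<mu> i \<in> measurable (filt i) (state_space N)"
proof (induction i)
  case 0
  have "chain \<mu> 0 = (\<lambda>_. (\<lambda>n\<in>{..<N}. 0, 0))" by (simp add: fun_eq_iff chain_0)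
  then show ?case using chain_0_in_space by simp
next
  case (Suc i)
  have 1: "chain \<mu> i \<in> measurable (filt (Suc i)) (state_space N)"
    by (rule measurable_innov_algebra_mono[OF _ Suc]) auto
  have 2: "innov_vec (Suc i) \<in> measurable (filt (Suc i)) innov_prod"
    by (rule measurable_innov_vec) auto
  have "(\<lambda>\<omega>. nstep N \<mu> (innov_vec (Suc i) \<omega>) (chain \<mu> i \<omega>)) \<in> measurable (filt (Suc i)) (state_space N)"
    using measurable_compose[OF measurable_Pair[OF 2 1] measurable_nstep[OF N_pos sets_innov_prod]] by simp
  then show ?case by (simp add: chain_Suc[abs_def])
qed

definition level :: "real \<Rightarrow> nat \<Rightarrow> 'a \<Rightarrow> real" where
  "level \<mu> i \<omega> = height N (chain \<mu> i \<omega>)"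

lemma measurable_level: "level \<mu> i \<in> borel_measurable (filt i)"
  unfolding level_def by (rule measurable_compose[OF measurable_chain measurable_height[OF N_pos]])

lemma level_0: "level \<mu> 0 \<omega> = 0"
  unfolding level_def chain_def by (rule height_nchain_0[OF N_pos])

text \<open>Given the past, a block started from an arbitrary configuration does at least as well as
  one started with all particles at the minimum. By monotonicity of the transition operator the
  expected deficit on \<open>A\<close> is therefore at most that of a fresh start, times the mass of
  \<open>A\<close>.\<close>

lemma level_increment_bound:
  assumes A: "A \<in> sets (filt i)"
  shows "(\<integral>\<^sup>+\<omega>. ennreal (C - min C (level \<mu> (i + L) \<omega> - level \<mu> i \<omega>)) * indicator A \<omega> \<partial>M)
    \<le> (\<integral>\<^sup>+\<omega>. ennreal (C - min C (level \<mu> L \<omega>)) \<partial>M) * emeasure M A"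
proof -
  define g where "g z = ennreal (C - min C (height N z))" for z
  have g[measurable]: "g \<in> borel_measurable (state_space N)"
    unfolding g_def using measurable_height[OF N_pos] by measurable
  have anti: "antitone g"
    unfolding antitone_def g_def using height_mono_dominated[OF N_pos]
    by (auto intro!: ennreal_leI simp: min_def) (meson order_trans)+
  have ev: "A \<in> events" using A sets_filt_events by auto
  \<comment> \<open>The raised reference level makes the height of \<open>Y l\<close> equal to the
    gain since time \<open>i\<close>.\<close>
  define Y where "Y l \<omega> = (fst (chain \<mu> (i + l) \<omega>), snd (chain \<mu> (i + l) \<omega>) + level \<mu> i \<omega>)" for l \<omega>
  have gY: "g (Y l \<omega>) = ennreal (C - min C (level \<mu> (i + l) \<omega> - level \<mu> i \<omega>))" for l \<omega>
    by (simp add: g_def Y_def level_def height_def algebra_simps)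
  have Y0: "Y 0 \<in> measurable (filt i) (state_space N)"
  proof -
    note [measurable] = measurable_compose[OF measurable_chain[of \<mu> i] measurable_fst]
      measurable_compose[OF measurable_chain[of \<mu> i] measurable_snd] measurable_level[of \<mu> i]
    show ?thesis unfolding Y_def add_0_right by measurable
  qed
  have YS: "Y (Suc l) \<omega> = nstep N \<mu> (innov_vec (Suc (i + l)) \<omega>) (Y l \<omega>)" for l \<omega>
    unfolding Y_def nstep_shift_level by (simp add: chain_Suc)
  let ?q = "(kern \<mu> ^^ L) g (\<lambda>n\<in>{..<N}. 0, 0)"
  have q: "(\<integral>\<^sup>+\<omega>. ennreal (C - min C (level \<mu> L \<omega>)) \<partial>M) = ?q"
  proof -
    have "(\<integral>\<^sup>+\<omega>. g (chain \<mu> L \<omega>) * indicator (space M) \<omega> \<partial>M) = (\<integral>\<^sup>+\<omega>. (kern \<mu> ^^ L) g (chain \<mu> 0 \<omega>) * indicator (space M) \<omega> \<partial>M)"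
      by (rule markov_kern[where i=0]) (use sets.top[of "filt 0"] measurable_chain[of \<mu> 0] chain_Suc in auto)
    also have "\<dots> = ?q" by (simp add: chain_0 emeasure_space_1)
    also have "(\<integral>\<^sup>+\<omega>. g (chain \<mu> L \<omega>) * indicator (space M) \<omega> \<partial>M) = (\<integral>\<^sup>+\<omega>. ennreal (C - min C (level \<mu> L \<omega>)) \<partial>M)"
      by (rule nn_integral_cong) (simp add: g_def level_def)
    finally show ?thesis .
  qed
  have "(\<integral>\<^sup>+\<omega>. g (Y L \<omega>) * indicator A \<omega> \<partial>M) = (\<integral>\<^sup>+\<omega>. (kern \<mu> ^^ L) g (Y 0 \<omega>) * indicator A \<omega> \<partial>M)"
    by (rule markov_kern[OF g A Y0 YS])
  also have "\<dots> \<le> (\<integral>\<^sup>+\<omega>. ?q * indicator A \<omega> \<partial>M)"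
  proof (intro nn_integral_mono mult_right_mono)
    fix \<omega> assume w: "\<omega> \<in> space M"
    have "Y 0 \<omega> \<in> space (state_space N)" using measurable_space[OF Y0] w by simp
    \<comment> \<open>Measured from the raised level the lowest particle sits at 0, so all particles
      are at or above 0.\<close>
    moreover have "dominated N (\<lambda>n\<in>{..<N}. 0, 0) (Y 0 \<omega>)"
      unfolding dominated_def
      by (rule exI[of _ id]) (auto simp: Y_def level_def height_def permutes_id)
    ultimately show "(kern \<mu> ^^ L) g (Y 0 \<omega>) \<le> ?q"
      using antitone_kern_funpow[OF g anti] chain_0_in_space unfolding antitone_def by blast
  qed simp
  also have "\<dots> = ?q * emeasure M A" using ev by (simp add: nn_integral_cmult)
  finally show ?thesis unfolding gY q .
qed

text \<open>A waiting time after step \<open>i\<close> is independent of \<open>A\<close> and has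
  mean \<open>1 / N\<close>. With \<open>A\<close> the event that passage has not yet occurred, this
  is the duration half of Wald's identity.\<close>

lemma nn_integral_wait:
  assumes A: "A \<in> sets (filt i)" and j: "i < j"
  shows "(\<integral>\<^sup>+\<omega>. ennreal (E j \<omega>) * indicator A \<omega> \<partial>M) = ennreal (1 / N) * emeasure M A"
proof -
  obtain l where l: "j = Suc l" "i \<le> l" using j by (cases j) auto
  have A': "A \<in> sets (filt l)" using A sets_innov_algebra_mono[of "{1..i}" "{1..l}"] l by auto
  have ev: "A \<in> events" using A sets_filt_events by auto
  let ?h = "\<lambda>p. ennreal (snd p N) * indicator A (fst p)"
  have "(\<lambda>u. u N) \<in> borel_measurable (\<Pi>\<^sub>M n\<in>{..<N + 2}. (borel :: real measure))"
    by (intro measurable_component_singleton) auto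
  then have [measurable]: "(\<lambda>u. u N) \<in> borel_measurable innov_prod"
    using sets_innov_prod by (simp cong: measurable_cong_sets)
  have h: "?h \<in> borel_measurable (filt l \<Otimes>\<^sub>M innov_prod)" using A' by measurable
  have E: "innov_vec j \<omega> N = E j \<omega>" for \<omega> by (simp add: innov_vec_def innov_def)
  have "(\<integral>\<^sup>+\<omega>. ennreal (E j \<omega>) * indicator A \<omega> \<partial>M) = (\<integral>\<^sup>+\<omega>. ?h (\<omega>, innov_vec (Suc l) \<omega>) \<partial>M)"
    by (simp add: E[unfolded l(1)] l(1))
  also have "\<dots> = (\<integral>\<^sup>+\<omega>. (\<integral>\<^sup>+u. ?h (\<omega>, u) \<partial>innov_prod) \<partial>M)"
    by (rule nn_integral_innov_vec[OF h])
  also have "\<dots> = (\<integral>\<^sup>+\<omega>. (\<integral>\<^sup>+u. ennreal (u N) \<partial>innov_prod) * indicator A \<omega> \<partial>M)"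
    by (rule nn_integral_cong) (simp add: indicator_def)
  also have "\<dots> = (\<integral>\<^sup>+u. ennreal (u N) \<partial>innov_prod) * emeasure M A"
    using ev by (simp add: nn_integral_cmult)
  also have "(\<integral>\<^sup>+u. ennreal (u N) \<partial>innov_prod) = ennreal (1 / N)"
  proof -
    have "(\<integral>\<^sup>+u. ennreal (u N) \<partial>innov_prod) = (\<integral>\<^sup>+u. ennreal (u N) \<partial>distr M innov_prod (innov_vec j))"
      using l by (simp add: distr_innov_vec)
    also have "\<dots> = (\<integral>\<^sup>+\<omega>. ennreal (E j \<omega>) \<partial>M)"
      using measurable_filt[OF measurable_innov_vec[of j "{1..j}"]] l
      by (subst nn_integral_distr) (auto simp: E[unfolded l(1)])
    also have "\<dots> = ennreal (expectation (\<lambda>\<omega>. E j \<omega>))"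
    proof (rule nn_integral_eq_integral)
      show "integrable M (E j)"
        using erlang_ith_moment_integrable[of N "E j" 0 1] Exp[of j] l N_pos by simp
      show "AE \<omega> in M. 0 \<le> E j \<omega>" using AE_E_pos by eventually_elim (use l in \<open>auto intro: less_imp_le\<close>)
    qed
    also have "expectation (\<lambda>\<omega>. E j \<omega>) = 1 / N"
      using exponential_distributed_expectation[of N "E j"] Exp[of j] l N_pos by simp
    finally show ?thesis .
  qed
  finally show ?thesis .
qed

end

section \<open>Positive drift over a long block\<close>

text \<open>A quantitative substitute for uniform integrability: a small multiple of the square can
  be integrated everywhere, while the large constant will be charged only on an event of small
  probability.\<close>

lemma le_eps_square:
  fixes x \<epsilon> :: real
  assumes "0 < \<epsilon>"
  shows "x \<le> \<epsilon> * x\<^sup>2 + 1 / (4 * \<epsilon>)"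
proof -
  have "0 \<le> (2 * \<epsilon> * x - 1)\<^sup>2" by simp
  then have "4 * \<epsilon> * x \<le> 4 * \<epsilon> * (\<epsilon> * x\<^sup>2) + 1" by (simp add: power2_eq_square algebra_simps)
  then show ?thesis using assms by (simp add: field_simps)
qed

context nbbm_noise
begin

abbreviation X1 :: "'a \<Rightarrow> real \<Rightarrow> real" where
  "X1 \<omega> \<equiv> nbbm_X1 N (\<lambda>n t. B n t \<omega>) (\<lambda>i. E i \<omega>) (\<lambda>i. K i \<omega>)"

lemma level_eq_X1: "AE \<omega> in M. \<forall>i. level \<mu> i \<omega> = X1 \<omega> (arrival i \<omega>) - \<mu> * arrival i \<omega>"
  using sqrt_innov AE_rank AE_E_pos
proof eventually_elim
  fix \<omega>
  assume 1: "\<forall>i. \<forall>n<N. sqrt (innov (Suc i) N \<omega>) * innov (Suc i) n \<omega>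
     = B n (arrival (Suc i) \<omega>) \<omega> - B n (arrival i \<omega>) \<omega>"
    and 2: "\<forall>i. rank_of N (innov (Suc i) (Suc N) \<omega>) = K (Suc i) \<omega>" and 3: "\<forall>i\<ge>1. 0 < E i \<omega>"
  show "\<forall>i. level \<mu> i \<omega> = X1 \<omega> (arrival i \<omega>) - \<mu> * arrival i \<omega>"
  proof
    fix i
    have state: "nbbm_state N (\<lambda>n t. B n t \<omega>) (\<lambda>i. E i \<omega>) (\<lambda>i. K i \<omega>) i n = fst (chain \<mu> i \<omega>) n"
      if "n < N" for n
      unfolding chain_def
      by (rule nbbm_state_eq_nchain[OF N_pos]) (use 1 2 that in \<open>auto simp: arrival_def\<close>)
    have "snd (chain \<mu> i \<omega>) = \<mu> * arrival i \<omega>"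
      unfolding chain_def snd_nchain arrival_def jump_time_def by (simp add: innov_def)
    moreover have "X1 \<omega> (arrival i \<omega>) = Min (fst (chain \<mu> i \<omega>) ` {..<N})"
      unfolding arrival_def by (rule nbbm_X1_jump_time[OF N_pos _ state]) (use 3 in auto)
    ultimately show "level \<mu> i \<omega> = X1 \<omega> (arrival i \<omega>) - \<mu> * arrival i \<omega>"
      by (simp add: level_def height_def)
  qed
qed

section \<open>Linear growth of the arrival times\<close>

lemma measurable_arrival[measurable]: "arrival i \<in> borel_measurable M"
  by (rule measurable_from_src(2)[OF measurable_src_arrival])

text \<open>Tilting the exponential density of rate \<open>N\<close> by this factor gives half the
  density of rate \<open>2 * N\<close>, which has total mass 1.\<close>

lemma nn_integral_exp_wait:
  assumes "1 \<le> i"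
  shows "(\<integral>\<^sup>+\<omega>. ennreal (exp (- (N * E i \<omega>))) \<partial>M) = ennreal (1 / 2)"
proof -
  have "(\<integral>\<^sup>+\<omega>. ennreal (exp (- (N * E i \<omega>))) \<partial>M)
      = (\<integral>\<^sup>+x. ennreal (exponential_density N x) * ennreal (exp (- (N * x))) \<partial>lborel)"
    by (rule distributed_nn_integral[OF Exp[OF assms], symmetric]) simp
  also have "\<dots> = (\<integral>\<^sup>+x. ennreal (1 / 2) * ennreal (exponential_density (2 * N) x) \<partial>lborel)"
  proof (rule nn_integral_cong)
    fix x :: real
    have "exponential_density N x * exp (- (N * x)) = 1 / 2 * exponential_density (2 * N) x"
      by (simp add: exponential_density_def exp_add[symmetric] algebra_simps)
    then show "ennreal (exponential_density N x) * ennreal (exp (- (N * x))) = ennreal (1 / 2) * ennreal (exponential_density (2 * N) x)"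
      using N_pos by (subst (1 2) ennreal_mult[symmetric]) (auto intro!: exponential_density_nonneg simp del: of_nat_mult)
  qed
  also have "\<dots> = ennreal (1 / 2) * emeasure (density lborel (exponential_density (2 * N))) (space lborel)"
    by (subst nn_integral_cmult) (auto simp: emeasure_density)
  also have "\<dots> = ennreal (1 / 2)"
    using prob_space.emeasure_space_1[OF prob_space_exponential_density[of "2 * N"]] N_pos by simp
  finally show ?thesis .
qed

text \<open>Chernoff's bound, with the exponential moment of order \<open>-N\<close>.\<close>
lemma prob_arrival_small: "prob {\<omega>\<in>space M. arrival L \<omega> < L / (2 * N)} \<le> (exp (1 / 2) / 2) ^ L"
proof -
  let ?A = "{\<omega>\<in>space M. arrival L \<omega> < L / (2 * N)}"
  have "indep_vars (\<lambda>_. borel) (\<lambda>p. case p of (i, n) \<Rightarrow> innov i n) ((\<lambda>i. (i, N)) ` {1..L})"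
    by (rule indep_vars_subset[OF indep_innov[of L]]) auto
  from indep_vars_inj_reindex[OF _ this]
  have "indep_vars (\<lambda>_. borel) (\<lambda>i. innov i N) {1..L}" by (simp add: inj_on_def)
  then have "indep_vars (\<lambda>_. borel) (\<lambda>i \<omega>. ennreal (exp (- (N * innov i N \<omega>)))) {1..L}"
    by (rule indep_vars_compose2) simp
  then have indep: "indep_vars (\<lambda>_. borel) (\<lambda>i \<omega>. ennreal (exp (- (N * E i \<omega>)))) {1..L}"
    by (simp add: innov_def)
  have "emeasure M ?A = (\<integral>\<^sup>+\<omega>. indicator ?A \<omega> \<partial>M)" by simp
  also have "\<dots> \<le> (\<integral>\<^sup>+\<omega>. ennreal (exp (L / 2)) * (\<Prod>i\<in>{1..L}. ennreal (exp (- (N * E i \<omega>)))) \<partial>M)"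
  proof (rule nn_integral_mono)
    fix \<omega>
    have "(\<Prod>i\<in>{1..L}. ennreal (exp (- (N * E i \<omega>)))) = ennreal (exp (- (N * arrival L \<omega>)))"
      by (simp add: prod_ennreal exp_sum[symmetric] arrival_def jump_time_def sum_negf sum_distrib_left)
    then have eq: "ennreal (exp (L / 2)) * (\<Prod>i\<in>{1..L}. ennreal (exp (- (N * E i \<omega>))))
      = ennreal (exp (L / 2 - N * arrival L \<omega>))"
      by (simp add: ennreal_mult[symmetric] exp_add[symmetric])
    show "indicator ?A \<omega> \<le> ennreal (exp (L / 2)) * (\<Prod>i\<in>{1..L}. ennreal (exp (- (N * E i \<omega>))))"
    proof (cases "\<omega> \<in> ?A")
      case True
      then have "N * arrival L \<omega> \<le> L / 2" using N_pos by (simp add: field_simps)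
      then have "1 \<le> exp (L / 2 - N * arrival L \<omega>)" by simp
      then show ?thesis unfolding eq using True by (simp add: ennreal_leI flip: ennreal_1)
    qed simp
  qed
  also have "\<dots> = ennreal (exp (L / 2)) * (\<Prod>i\<in>{1..L}. \<integral>\<^sup>+\<omega>. ennreal (exp (- (N * E i \<omega>))) \<partial>M)"
  proof (subst nn_integral_cmult)
    show "(\<lambda>\<omega>. \<Prod>i\<in>{1..L}. ennreal (exp (- (N * E i \<omega>)))) \<in> borel_measurable M"
    proof (rule borel_measurable_prod_ennreal)
      fix i assume "i \<in> {1..L}"
      then have [measurable]: "E i \<in> borel_measurable M" by (intro measurable_E) auto
      show "(\<lambda>\<omega>. ennreal (exp (- (N * E i \<omega>)))) \<in> borel_measurable M" by measurable
    qed
    show "ennreal (exp (L / 2)) * (\<integral>\<^sup>+\<omega>. (\<Prod>i\<in>{1..L}. ennreal (exp (- (N * E i \<omega>)))) \<partial>M)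
      = ennreal (exp (L / 2)) * (\<Prod>i\<in>{1..L}. \<integral>\<^sup>+\<omega>. ennreal (exp (- (N * E i \<omega>))) \<partial>M)"
      by (subst indep_vars_nn_integral[OF _ indep]) auto
  qed
  also have "(\<Prod>i\<in>{1..L}. \<integral>\<^sup>+\<omega>. ennreal (exp (- (N * E i \<omega>))) \<partial>M) = (\<Prod>i\<in>{1..L}. ennreal (1 / 2))"
    by (intro prod.cong refl) (simp add: nn_integral_exp_wait)
  also have "\<dots> = ennreal ((1 / 2) ^ L)"
    unfolding prod_constant card_atLeastAtMost by (subst ennreal_power) simp_all
  also have "ennreal (exp (L / 2)) * ennreal ((1 / 2) ^ L) = ennreal ((exp (1 / 2) / 2) ^ L)"
    by (simp add: ennreal_mult[symmetric] power_divide exp_of_nat_mult[symmetric] field_simps)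
  finally show ?thesis unfolding emeasure_eq_measure by (simp add: ennreal_le_iff)
qed

text \<open>The mean of \<open>arrival L\<close> is \<open>L / N\<close>, and half of it is enough.
  Since \<open>exp 1 \<le> 3 < 4\<close>, the ratio \<open>exp (1 / 2) / 2\<close> is below 1, so
  the Chernoff bounds are summable and Borel-Cantelli applies.\<close>

lemma arrival_linear: "AE \<omega> in M. eventually (\<lambda>L. L / (2 * N) \<le> arrival L \<omega>) sequentially"
proof -
  have "exp (1 / 2) < (2 :: real)"
  proof (rule power2_less_imp_less)
    have "(exp (1 / 2))\<^sup>2 = exp (1 :: real)" by (simp add: power2_eq_square exp_add[symmetric])
    then show "(exp (1 / 2))\<^sup>2 < (2 :: real)\<^sup>2" using exp_le by simp
  qed simp
  then have "summable (\<lambda>L. (exp (1 / 2) / 2 :: real) ^ L)" by (intro summable_geometric) auto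
  then have "summable (\<lambda>L. prob {\<omega>\<in>space M. arrival L \<omega> < L / (2 * N)})"
    by (rule summable_comparison_test'[where N=0]) (unfold real_norm_def abs_of_nonneg[OF measure_nonneg], rule prob_arrival_small)
  then have "AE \<omega> in M. eventually (\<lambda>L. \<omega> \<in> space M - {\<omega>\<in>space M. arrival L \<omega> < L / (2 * N)}) sequentially"
    by (intro borel_cantelli_AE1) (auto simp: less_top[symmetric])
  then show ?thesis by eventually_elim (auto elim: eventually_mono)
qed

section \<open>Moment bounds and the expected deficit\<close>

lemma wait_moment:
  assumes "1 \<le> i"
  shows "integrable M (\<lambda>\<omega>. (E i \<omega>)\<^sup>2)" "expectation (\<lambda>\<omega>. (E i \<omega>)\<^sup>2) = 2 / N\<^sup>2"
  using erlang_ith_moment_integrable[of N "E i" 0 2] erlang_ith_moment[of N "E i" 0 2] Exp[OF assms] N_pos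
  by (simp_all add: fact_numeral)

lemma gauss_moment:
  assumes i: "1 \<le> i" and n: "n < N"
  shows "integrable M (\<lambda>\<omega>. (innov i n \<omega>) ^ 4)" "expectation (\<lambda>\<omega>. (innov i n \<omega>) ^ 4) = 3"
proof -
  have "distr M lborel (innov i n) = distr M borel (innov i n)" by (rule distr_cong) auto
  then have D: "distributed M lborel (innov i n) std_normal_density"
    unfolding distributed_def using measurable_innov[OF i, of n] distr_innov[OF i, of n] n
    by (simp add: innov_law_def)
  have "integrable lborel (\<lambda>x. std_normal_density x * x ^ 4)" "(\<integral>x. std_normal_density x * x ^ 4 \<partial>lborel) = 3"
    using std_normal_moment_even[of 2] integral_std_normal_moment_even[of 2]
    by (auto simp: has_bochner_integral_iff fact_numeral)
  then show "integrable M (\<lambda>\<omega>. (innov i n \<omega>) ^ 4)" "expectation (\<lambda>\<omega>. (innov i n \<omega>) ^ 4) = 3"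
    using distributed_integrable[OF D, of "\<lambda>x. x ^ 4"] distributed_integral[OF D, of "\<lambda>x. x ^ 4"] by auto
qed

text \<open>The deficit vanishes unless the level is below \<open>C\<close>. There it is at most
  \<open>C\<close> plus a sum of waiting times and squared Gaussians, to which
  \<open>le_eps_square\<close> is applied term by term. The quadratic parts contribute \<epsilon>
  times \<open>L\<close> second and fourth moments; the constants are multiplied by the probability
  of the bad event.\<close>

lemma level_deficit_bound:
  fixes \<mu> \<epsilon> C :: real
  assumes \<epsilon>: "0 < \<epsilon>" and C: "0 \<le> C"
  shows "(\<integral>\<^sup>+\<omega>. ennreal (C - min C (level \<mu> L \<omega>)) \<partial>M)
    \<le> ennreal (prob {\<omega>\<in>space M. level \<mu> L \<omega> < C} * (C + L * ((\<bar>\<mu>\<bar> + 2 * N) / (4 * \<epsilon>)))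
        + \<epsilon> * (L * ((\<bar>\<mu>\<bar> + N) * (2 / N\<^sup>2) + N * 3)))"
proof -
  define bad where "bad = {\<omega>\<in>space M. level \<mu> L \<omega> < C}"
  have [measurable]: "level \<mu> L \<in> borel_measurable M" by (rule measurable_filt[OF measurable_level])
  have bad[measurable]: "bad \<in> events" unfolding bad_def by measurable
  let ?a = "\<bar>\<mu>\<bar> + N"
  let ?S = "\<lambda>\<omega>. \<Sum>j=1..L. ?a * (E j \<omega>)\<^sup>2 + (\<Sum>n<N. (innov j n \<omega>) ^ 4)"
  \<comment> \<open>Each jump has a waiting time with weight \<open>\<bar>\<mu>\<bar> + N\<close>
    and \<open>N\<close> Gaussians, hence total weight \<open>\<bar>\<mu>\<bar> + 2 * N\<close> for
    the constant \<open>1 / (4 * \<epsilon>)\<close>.\<close>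
  let ?d = "C + L * ((\<bar>\<mu>\<bar> + 2 * N) / (4 * \<epsilon>))"
  let ?f = "\<lambda>\<omega>. ?d * indicator bad \<omega> + \<epsilon> * ?S \<omega>"
  have int1: "integrable M (\<lambda>\<omega>. ?a * (E j \<omega>)\<^sup>2 + (\<Sum>n<N. (innov j n \<omega>) ^ 4))" if "j \<in> {1..L}" for j
    using that by (intro Bochner_Integration.integrable_add integrable_mult_right Bochner_Integration.integrable_sum wait_moment gauss_moment) auto
  have intS: "integrable M ?S" by (rule Bochner_Integration.integrable_sum) (rule int1)
  have expS: "expectation ?S = L * (?a * (2 / N\<^sup>2) + N * 3)"
  proof -
    have "expectation (\<lambda>\<omega>. ?a * (E j \<omega>)\<^sup>2 + (\<Sum>n<N. (innov j n \<omega>) ^ 4)) = ?a * (2 / N\<^sup>2) + N * 3" if j: "j \<in> {1..L}" for j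
    proof -
      have j1: "1 \<le> j" using j by auto
      have "expectation (\<lambda>\<omega>. ?a * (E j \<omega>)\<^sup>2 + (\<Sum>n<N. (innov j n \<omega>) ^ 4))
         = ?a * expectation (\<lambda>\<omega>. (E j \<omega>)\<^sup>2) + (\<Sum>n<N. expectation (\<lambda>\<omega>. (innov j n \<omega>) ^ 4))"
        using wait_moment(1)[OF j1] gauss_moment(1)[OF j1]
        by (subst Bochner_Integration.integral_add) (auto intro!: Bochner_Integration.integrable_sum)
      also have "(\<Sum>n<N. expectation (\<lambda>\<omega>. (innov j n \<omega>) ^ 4)) = (\<Sum>n<N. 3)"
        by (rule sum.cong) (auto simp: gauss_moment(2)[OF j1])
      finally show ?thesis using wait_moment(2)[OF j1] by simp
    qed
    then show ?thesis by (subst Bochner_Integration.integral_sum) (rule int1, assumption, simp)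
  qed
  have intf: "integrable M ?f"
    using intS by (intro Bochner_Integration.integrable_add integrable_mult_right) (auto simp: less_top[symmetric])
  have "(\<integral>\<^sup>+\<omega>. ennreal (C - min C (level \<mu> L \<omega>)) \<partial>M) \<le> (\<integral>\<^sup>+\<omega>. ennreal (?f \<omega>) \<partial>M)"
  proof (rule nn_integral_mono_AE)
    show "AE \<omega> in M. ennreal (C - min C (level \<mu> L \<omega>)) \<le> ennreal (?f \<omega>)"
      using AE_E_pos AE_space
    proof eventually_elim
      fix \<omega> assume pos: "\<forall>i\<ge>1. 0 < E i \<omega>" and w: "\<omega> \<in> space M"
      have "0 \<le> ?S \<omega>" by (intro sum_nonneg add_nonneg_nonneg mult_nonneg_nonneg) auto
      then have S: "0 \<le> \<epsilon> * ?S \<omega>" using \<epsilon> by simp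
      show "ennreal (C - min C (level \<mu> L \<omega>)) \<le> ennreal (?f \<omega>)"
      proof (cases "\<omega> \<in> bad")
        case False
        then have "C - min C (level \<mu> L \<omega>) = 0" using w by (auto simp: bad_def)
        then show ?thesis using S False by simp
      next
        case True
        have "- level \<mu> L \<omega> \<le> (\<Sum>j=1..L. ?a * E j \<omega> + (\<Sum>n<N. (innov j n \<omega>)\<^sup>2))"
          using height_nchain_ge[OF N_pos, of "\<lambda>j n. innov j n \<omega>" \<mu> L] pos
          by (simp add: level_def chain_def innov_def[of _ N] less_imp_le)
        also have "\<dots> \<le> (\<Sum>j=1..L. \<epsilon> * (?a * (E j \<omega>)\<^sup>2 + (\<Sum>n<N. (innov j n \<omega>) ^ 4)) + (\<bar>\<mu>\<bar> + 2 * N) / (4 * \<epsilon>))"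
        proof (rule sum_mono)
          fix j
          have "?a * E j \<omega> \<le> ?a * (\<epsilon> * (E j \<omega>)\<^sup>2 + 1 / (4 * \<epsilon>))"
            by (intro mult_left_mono le_eps_square[OF \<epsilon>]) auto
          moreover have "(\<Sum>n<N. (innov j n \<omega>)\<^sup>2) \<le> (\<Sum>n<N. \<epsilon> * (innov j n \<omega>) ^ 4 + 1 / (4 * \<epsilon>))"
            using le_eps_square[OF \<epsilon>, of "(innov j _ \<omega>)\<^sup>2"] by (intro sum_mono) simp
          ultimately have "?a * E j \<omega> + (\<Sum>n<N. (innov j n \<omega>)\<^sup>2)
              \<le> ?a * (\<epsilon> * (E j \<omega>)\<^sup>2 + 1 / (4 * \<epsilon>)) + (\<Sum>n<N. \<epsilon> * (innov j n \<omega>) ^ 4 + 1 / (4 * \<epsilon>))"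
            by linarith
          also have "\<dots> = \<epsilon> * (?a * (E j \<omega>)\<^sup>2 + (\<Sum>n<N. (innov j n \<omega>) ^ 4)) + (\<bar>\<mu>\<bar> + 2 * N) / (4 * \<epsilon>)"
            by (simp add: sum.distrib sum_distrib_left algebra_simps add_divide_distrib)
          finally show "?a * E j \<omega> + (\<Sum>n<N. (innov j n \<omega>)\<^sup>2)
              \<le> \<epsilon> * (?a * (E j \<omega>)\<^sup>2 + (\<Sum>n<N. (innov j n \<omega>) ^ 4)) + (\<bar>\<mu>\<bar> + 2 * N) / (4 * \<epsilon>)" .
        qed
        also have "\<dots> = \<epsilon> * ?S \<omega> + L * ((\<bar>\<mu>\<bar> + 2 * N) / (4 * \<epsilon>))"
        proof -
          have "(\<Sum>j=1..L. \<epsilon> * T j + k) = \<epsilon> * (\<Sum>j=1..L. T j) + L * k" for T and k :: real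
            by (simp add: sum.distrib sum_distrib_left)
          then show ?thesis .
        qed
        finally show ?thesis using True by (intro ennreal_leI) (simp add: bad_def)
      qed
    qed
  qed
  also have "\<dots> = ennreal (expectation ?f)"
  proof (rule nn_integral_eq_integral[OF intf], rule AE_I2)
    fix \<omega>
    have "0 \<le> ?S \<omega>" by (intro sum_nonneg add_nonneg_nonneg mult_nonneg_nonneg) auto
    then show "0 \<le> ?f \<omega>" using \<epsilon> C by simp
  qed
  also have "expectation ?f = ?d * prob bad + \<epsilon> * expectation ?S"
    using intS by (subst Bochner_Integration.integral_add) (auto simp: less_top[symmetric])
  finally show ?thesis unfolding expS bad_def by (simp only: mult.commute)
qed

text \<open>A fresh start reaches \<open>c * L\<close> except with vanishing probability, so with
  \<open>C = c * L\<close> both terms of \<open>level_deficit_bound\<close> can be made at most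
  \<open>C / 4\<close>: first by choosing \<epsilon>, which controls the moment term for every
  \<open>L\<close>, then by taking \<open>L\<close> large.\<close>

lemma ex_drift_block:
  assumes speed: "AE \<omega> in M. ((\<lambda>t. X1 \<omega> t / t) \<longlongrightarrow> v) at_top" and \<mu>: "\<mu> < v"
  shows "\<exists>L C. 1 \<le> L \<and> 0 < C \<and> (\<integral>\<^sup>+\<omega>. ennreal (C - min C (level \<mu> L \<omega>)) \<partial>M) \<le> ennreal (C / 2)"
proof -
  \<comment> \<open>Half of the excess speed \<open>v - \<mu>\<close>, times the guaranteed time
    \<open>1 / (2 * N)\<close> per jump.\<close>
  define c where "c = (v - \<mu>) / (4 * N)"
  have c: "0 < c" using \<mu> N_pos by (simp add: c_def)
  have ev: "AE \<omega> in M. eventually (\<lambda>L. c * L \<le> level \<mu> L \<omega>) sequentially"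
    using speed level_eq_X1[of \<mu>] arrival_linear
  proof eventually_elim
    fix \<omega> assume sp: "((\<lambda>t. X1 \<omega> t / t) \<longlongrightarrow> v) at_top"
      and lev: "\<forall>i. level \<mu> i \<omega> = X1 \<omega> (arrival i \<omega>) - \<mu> * arrival i \<omega>"
      and lin: "eventually (\<lambda>L. L / (2 * N) \<le> arrival L \<omega>) sequentially"
    have "filterlim (\<lambda>L. real L / (2 * N)) at_top sequentially"
      using filterlim_tendsto_pos_mult_at_top[OF tendsto_const[of "1 / (2 * real N)"] _ filterlim_real_sequentially] N_pos
      by simp
    from filterlim_at_top_mono[OF this lin]
    have lim: "filterlim (\<lambda>L. arrival L \<omega>) at_top sequentially" .
    have "eventually (\<lambda>t. (v + \<mu>) / 2 < X1 \<omega> t / t) at_top"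
      using sp \<mu> by (intro order_tendstoD(1)) auto
    with eventually_gt_at_top[of 0] have "eventually (\<lambda>t. (v + \<mu>) / 2 * t \<le> X1 \<omega> t) at_top"
      by eventually_elim (auto simp: field_simps)
    from lim[unfolded filterlim_iff, rule_format, OF this] lin
    show "eventually (\<lambda>L. c * L \<le> level \<mu> L \<omega>) sequentially"
    proof eventually_elim
      fix L assume 1: "(v + \<mu>) / 2 * arrival L \<omega> \<le> X1 \<omega> (arrival L \<omega>)" and 2: "L / (2 * N) \<le> arrival L \<omega>"
      have "c * L = (v - \<mu>) / 2 * (L / (2 * N))" by (simp add: c_def)
      also have "\<dots> \<le> (v - \<mu>) / 2 * arrival L \<omega>" by (rule mult_left_mono[OF 2]) (use \<mu> in simp)
      also have "\<dots> \<le> level \<mu> L \<omega>" using 1 unfolding lev[rule_format] by (simp add: field_simps)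
      finally show "c * L \<le> level \<mu> L \<omega>" .
    qed
  qed
  define bad where "bad L = {\<omega>\<in>space M. level \<mu> L \<omega> < c * L}" for L
  have [measurable]: "level \<mu> L \<in> borel_measurable M" for L by (rule measurable_filt[OF measurable_level])
  have [measurable]: "bad L \<in> events" for L unfolding bad_def by measurable
  \<comment> \<open>Almost sure eventual avoidance of the bad events makes their probabilities tend
    to 0, by dominated convergence.\<close>
  have "(\<lambda>L. expectation (\<lambda>\<omega>. indicator (bad L) \<omega> :: real)) \<longlonglongrightarrow> expectation (\<lambda>\<omega>. 0)"
  proof (rule integral_dominated_convergence[where w="\<lambda>_. 1"])
    show "AE \<omega> in M. (\<lambda>L. indicator (bad L) \<omega> :: real) \<longlonglongrightarrow> 0"
      using ev
    proof eventually_elim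
      fix \<omega> assume "eventually (\<lambda>L. c * L \<le> level \<mu> L \<omega>) sequentially"
      then have "eventually (\<lambda>L. indicator (bad L) \<omega> = (0::real)) sequentially"
        by eventually_elim (auto simp: bad_def)
      then show "(\<lambda>L. indicator (bad L) \<omega> :: real) \<longlonglongrightarrow> 0" by (rule tendsto_eventually)
    qed
  qed (auto simp: indicator_def)
  then have lim: "(\<lambda>L. prob (bad L)) \<longlonglongrightarrow> 0" by simp
  define \<kappa> where "\<kappa> = (\<bar>\<mu>\<bar> + N) * (2 / N\<^sup>2) + N * 3"
  have \<kappa>: "0 \<le> \<kappa>" by (simp add: \<kappa>_def)
  \<comment> \<open>The denominator uses \<open>\<kappa> + 1\<close> so that it is certainly
    positive.\<close>
  define \<epsilon> where "\<epsilon> = c / (4 * (\<kappa> + 1))"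
  have \<epsilon>: "0 < \<epsilon>" using c \<kappa> by (simp add: \<epsilon>_def)
  have \<epsilon>\<kappa>: "\<epsilon> * \<kappa> \<le> c / 4"
  proof -
    have "\<epsilon> * \<kappa> \<le> \<epsilon> * (\<kappa> + 1)" using \<epsilon> by simp
    also have "\<dots> = c / 4" using \<kappa> by (simp add: \<epsilon>_def field_simps)
    finally show ?thesis .
  qed
  \<comment> \<open>The cost per jump incurred on the bad event; it does not depend on
    \<open>L\<close>, so \<open>prob (bad L) < c / (4 * d)\<close> can be demanded
    afterwards.\<close>
  define d where "d = c + (\<bar>\<mu>\<bar> + 2 * N) / (4 * \<epsilon>)"
  have d: "0 < d" using c \<epsilon> by (simp add: d_def add_pos_nonneg)
  have "eventually (\<lambda>L. prob (bad L) < c / (4 * d)) sequentially"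
    using lim c d by (intro order_tendstoD(2)) auto
  from eventually_conj[OF this eventually_ge_at_top[of "1::nat"]]
  obtain L where L: "prob (bad L) < c / (4 * d)" "1 \<le> L"
    by (auto simp: eventually_sequentially)
  have "(\<integral>\<^sup>+\<omega>. ennreal (c * L - min (c * L) (level \<mu> L \<omega>)) \<partial>M)
      \<le> ennreal (prob (bad L) * (c * L + L * ((\<bar>\<mu>\<bar> + 2 * N) / (4 * \<epsilon>))) + \<epsilon> * (L * \<kappa>))"
    using level_deficit_bound[OF \<epsilon>, of "c * L" \<mu> L] c unfolding bad_def \<kappa>_def by simp
  also have "\<dots> \<le> ennreal (c * L / 2)"
  proof (rule ennreal_leI)
    have "prob (bad L) * d \<le> c / 4" using L(1) d by (simp add: field_simps)
    then have "L * (prob (bad L) * d + \<epsilon> * \<kappa>) \<le> L * (c / 2)"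
      using \<epsilon>\<kappa> by (intro mult_left_mono) auto
    then show "prob (bad L) * (c * L + L * ((\<bar>\<mu>\<bar> + 2 * N) / (4 * \<epsilon>))) + \<epsilon> * (L * \<kappa>) \<le> c * L / 2"
      by (simp add: d_def algebra_simps)
  qed
  finally show ?thesis using L(2) c by (intro exI[of _ L] exI[of _ "c * L"]) auto
qed

end

section \<open>First passage\<close>

context nbbm_noise
begin

text \<open>The event that the first passage, observed at block ends, comes after block
  \<open>k\<close>. The range starts at 1, so \<open>below \<mu> L R 0\<close> is the whole space
  and the first block is always run.\<close>

definition below :: "real \<Rightarrow> nat \<Rightarrow> real \<Rightarrow> nat \<Rightarrow> 'a set" where
  "below \<mu> L R k = {\<omega>\<in>space M. \<forall>j\<in>{1..k}. level \<mu> (j * L) \<omega> < R}"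

lemma below_filt: "below \<mu> L R k \<in> sets (filt (k * L))"
proof -
  have [measurable]: "level \<mu> (j * L) \<in> borel_measurable (filt (k * L))" if "j \<in> {1..k}" for j
    by (rule measurable_innov_algebra_mono[OF _ measurable_level]) (use that in \<open>auto intro: order_trans mult_le_mono1\<close>)
  have "{\<omega>\<in>space (filt (k * L)). level \<mu> (j * L) \<omega> < R} \<in> sets (filt (k * L))" if "j \<in> {1..k}" for j
    using that by measurable
  then have "{\<omega>\<in>space (filt (k * L)). \<forall>j\<in>{1..k}. level \<mu> (j * L) \<omega> < R} \<in> sets (filt (k * L))"
    by (rule sets.sets_Collect_finite_All) simp_all
  then show ?thesis by (simp add: below_def)
qed

lemma below_Suc: "\<omega> \<in> below \<mu> L R (Suc k) \<longleftrightarrow> \<omega> \<in> below \<mu> L R k \<and> level \<mu> (Suc k * L) \<omega> < R"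
  by (auto simp: below_def atLeastAtMostSuc_conv)

text \<open>Wald's identity with increments truncated at \<open>C\<close>: up to the first passage above \<open>R\<close>, the
  truncated increments add up to at most \<open>R + C\<close>, while each has conditional mean at least \<open>C / 2\<close>.\<close>
lemma sum_prob_below:
  assumes C: "0 < C" and R: "0 < R"
    and q: "(\<integral>\<^sup>+\<omega>. ennreal (C - min C (level \<mu> L \<omega>)) \<partial>M) \<le> ennreal (C / 2)"
  shows "(\<Sum>k<n. prob (below \<mu> L R k)) \<le> 2 * (R + C) / C"
proof -
  let ?A = "below \<mu> L R" and ?H = "\<lambda>k. level \<mu> (k * L)"
  let ?\<theta> = "\<lambda>k \<omega>. C - min C (?H (Suc k) \<omega> - ?H k \<omega>)"
  have A[measurable]: "?A k \<in> events" for k using below_filt sets_filt_events by blast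
  have [measurable]: "level \<mu> i \<in> borel_measurable M" for i by (rule measurable_filt[OF measurable_level])
  \<comment> \<open>Before passage the truncated gains add up to at most the current level. The
    block that crosses starts below \<open>R\<close> and contributes at most \<open>C\<close>;
    afterwards the indicators are 0 and the sum is frozen.\<close>
  have le: "(\<Sum>k<n. min C (?H (Suc k) \<omega> - ?H k \<omega>) * indicator (?A k) \<omega>)
      \<le> (if \<omega> \<in> ?A n then ?H n \<omega> else R + C)" if w: "\<omega> \<in> space M" for n \<omega>
  proof (induction n)
    case 0
    show ?case using w by (simp add: below_def level_0)
  next
    case (Suc n)
    show ?case
    proof (cases "\<omega> \<in> ?A n")
      case True
      have "?H n \<omega> < R"
        using True R below_Suc[of \<omega> \<mu> L R "n - 1"] by (cases n) (auto simp: level_0)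
      then show ?thesis using Suc True below_Suc[of \<omega> \<mu> L R n] by (auto simp: min_def split: if_splits)
    next
      case False
      then show ?thesis using Suc below_Suc[of \<omega> \<mu> L R n] by simp
    qed
  qed
  \<comment> \<open>Rewritten with the deficits instead of the truncated gains, so that every
    summand is nonnegative and can be integrated in \<open>ennreal\<close>.\<close>
  have pt: "(\<Sum>k<n. C * indicator (?A k) \<omega>) \<le> (R + C) + (\<Sum>k<n. ?\<theta> k \<omega> * indicator (?A k) \<omega>)"
    if w: "\<omega> \<in> space M" for \<omega>
  proof -
    have "(if \<omega> \<in> ?A n then ?H n \<omega> else R + C) \<le> R + C"
      using R C below_Suc[of \<omega> \<mu> L R "n - 1"] by (cases n) (auto simp: level_0)
    moreover have "(\<Sum>k<n. C * indicator (?A k) \<omega>) - (\<Sum>k<n. ?\<theta> k \<omega> * indicator (?A k) \<omega>)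
       = (\<Sum>k<n. min C (?H (Suc k) \<omega> - ?H k \<omega>) * indicator (?A k) \<omega>)"
      unfolding sum_subtractf[symmetric] by (rule sum.cong) (auto simp: algebra_simps)
    ultimately show ?thesis using le[OF w, of n] by linarith
  qed
  define s where "s = (\<Sum>k<n. prob (?A k))"
  have s: "0 \<le> s" unfolding s_def by (rule sum_nonneg) simp
  have "ennreal (C * s) = (\<Sum>k<n. ennreal C * emeasure M (?A k))"
    using C unfolding s_def by (simp add: emeasure_eq_measure ennreal_mult[symmetric] sum_ennreal sum_distrib_left)
  also have "\<dots> = (\<integral>\<^sup>+\<omega>. (\<Sum>k<n. ennreal C * indicator (?A k) \<omega>) \<partial>M)"
    by (subst nn_integral_sum) (auto simp: nn_integral_cmult)
  also have "\<dots> \<le> (\<integral>\<^sup>+\<omega>. ennreal (R + C) + (\<Sum>k<n. ennreal (?\<theta> k \<omega>) * indicator (?A k) \<omega>) \<partial>M)"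
  proof (rule nn_integral_mono)
    fix \<omega> assume w: "\<omega> \<in> space M"
    have "(\<Sum>k<n. ennreal C * indicator (?A k) \<omega>) = ennreal (\<Sum>k<n. C * indicator (?A k) \<omega>)"
      using C by (subst sum_ennreal[symmetric]) (auto simp: ennreal_mult ennreal_indicator)
    also have "\<dots> \<le> ennreal ((R + C) + (\<Sum>k<n. ?\<theta> k \<omega> * indicator (?A k) \<omega>))"
      by (rule ennreal_leI[OF pt[OF w]])
    also have "\<dots> = ennreal (R + C) + (\<Sum>k<n. ennreal (?\<theta> k \<omega>) * indicator (?A k) \<omega>)"
    proof -
      have "ennreal (\<Sum>k<n. ?\<theta> k \<omega> * indicator (?A k) \<omega>) = (\<Sum>k<n. ennreal (?\<theta> k \<omega> * indicator (?A k) \<omega>))"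
        by (rule sum_ennreal[symmetric]) simp
      also have "\<dots> = (\<Sum>k<n. ennreal (?\<theta> k \<omega>) * indicator (?A k) \<omega>)"
        by (rule sum.cong) (auto split: split_indicator)
      finally show ?thesis
        using R C by (subst ennreal_plus) (auto intro!: sum_nonneg)
    qed
    finally show "(\<Sum>k<n. ennreal C * indicator (?A k) \<omega>) \<le> ennreal (R + C) + (\<Sum>k<n. ennreal (?\<theta> k \<omega>) * indicator (?A k) \<omega>)" .
  qed
  also have "\<dots> = ennreal (R + C) + (\<Sum>k<n. \<integral>\<^sup>+\<omega>. ennreal (?\<theta> k \<omega>) * indicator (?A k) \<omega> \<partial>M)"
  proof -
    have \<theta>: "(\<lambda>\<omega>. ennreal (?\<theta> k \<omega>) * indicator (?A k) \<omega>) \<in> borel_measurable M" for k by measurable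
    have "(\<lambda>\<omega>. \<Sum>k<n. ennreal (?\<theta> k \<omega>) * indicator (?A k) \<omega>) \<in> borel_measurable M"
      by (rule borel_measurable_sum) (rule \<theta>)
    then have "(\<integral>\<^sup>+\<omega>. ennreal (R + C) + (\<Sum>k<n. ennreal (?\<theta> k \<omega>) * indicator (?A k) \<omega>) \<partial>M)
        = (\<integral>\<^sup>+\<omega>. ennreal (R + C) \<partial>M) + (\<integral>\<^sup>+\<omega>. (\<Sum>k<n. ennreal (?\<theta> k \<omega>) * indicator (?A k) \<omega>) \<partial>M)"
      by (intro nn_integral_add) auto
    also have "(\<integral>\<^sup>+\<omega>. (\<Sum>k<n. ennreal (?\<theta> k \<omega>) * indicator (?A k) \<omega>) \<partial>M)
        = (\<Sum>k<n. \<integral>\<^sup>+\<omega>. ennreal (?\<theta> k \<omega>) * indicator (?A k) \<omega> \<partial>M)"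
      by (rule nn_integral_sum) (rule \<theta>)
    finally show ?thesis by (simp add: emeasure_space_1)
  qed
  also have "\<dots> \<le> ennreal (R + C) + (\<Sum>k<n. ennreal (C / 2) * emeasure M (?A k))"
  proof (intro add_left_mono sum_mono)
    fix k
    have "(\<integral>\<^sup>+\<omega>. ennreal (?\<theta> k \<omega>) * indicator (?A k) \<omega> \<partial>M)
        \<le> (\<integral>\<^sup>+\<omega>. ennreal (C - min C (level \<mu> L \<omega>)) \<partial>M) * emeasure M (?A k)"
      using level_increment_bound[OF below_filt[of \<mu> L R k], of C \<mu> L] by (simp add: add.commute)
    also have "\<dots> \<le> ennreal (C / 2) * emeasure M (?A k)" by (rule mult_right_mono[OF q]) simp
    finally show "(\<integral>\<^sup>+\<omega>. ennreal (?\<theta> k \<omega>) * indicator (?A k) \<omega> \<partial>M) \<le> ennreal (C / 2) * emeasure M (?A k)" .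
  qed
  also have "\<dots> = ennreal (R + C + C / 2 * s)"
  proof -
    have "(\<Sum>k<n. ennreal (C / 2) * emeasure M (?A k)) = ennreal (C / 2 * s)"
      using C unfolding s_def by (simp add: emeasure_eq_measure ennreal_mult[symmetric] sum_ennreal sum_distrib_left)
    then show ?thesis using R C s by (simp add: ennreal_plus)
  qed
  \<comment> \<open>As \<open>s\<close> is a finite sum of probabilities, the term
    \<open>C / 2 * s\<close> can be absorbed on the left.\<close>
  finally have "C * s \<le> R + C + C / 2 * s"
    using R C s by (subst (asm) ennreal_le_iff) auto
  then show ?thesis using C unfolding s_def[symmetric] by (simp add: field_simps)
qed

text \<open>The right-hand side adds the durations of all blocks begun before passage. It reaches
  the arrival time at the end of the crossing block, where the process itself is at or above
  \<open>R\<close>; if passage never occurs it is infinite.\<close>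

lemma hit_time_le:
  assumes R: "0 < R" and L: "1 \<le> L"
  shows "AE \<omega> in M. hit_time (X1 \<omega>) \<mu> R
    \<le> (\<Sum>k. (\<Sum>l<L. ennreal (E (k * L + Suc l) \<omega>)) * indicator (below \<mu> L R k) \<omega>)"
  using level_eq_X1[of \<mu>] AE_E_pos arrival_linear AE_space
proof eventually_elim
  fix \<omega> assume lev: "\<forall>i. level \<mu> i \<omega> = X1 \<omega> (arrival i \<omega>) - \<mu> * arrival i \<omega>"
    and pos: "\<forall>i\<ge>1. 0 < E i \<omega>" and lin: "eventually (\<lambda>L. L / (2 * N) \<le> arrival L \<omega>) sequentially"
    and w: "\<omega> \<in> space M"
  let ?D = "\<lambda>k. \<Sum>l<L. ennreal (E (k * L + Suc l) \<omega>)"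
  let ?s = "\<Sum>k. ?D k * indicator (below \<mu> L R k) \<omega>"
  have arr_nonneg: "0 \<le> arrival i \<omega>" for i
    unfolding arrival_def jump_time_def by (rule sum_nonneg) (use pos in \<open>auto intro: less_imp_le\<close>)
  have D: "?D k = ennreal (\<Sum>l<L. E (k * L + Suc l) \<omega>)" for k
    using pos by (subst sum_ennreal) (auto intro: less_imp_le)
  have arr_add: "arrival (i + m) \<omega> = arrival i \<omega> + (\<Sum>l<m. E (i + Suc l) \<omega>)" for i m
    by (induction m) (auto simp: arrival_def jump_time_def)
  have sumD: "(\<Sum>k<m. ?D k) = ennreal (arrival (m * L) \<omega>)" for m
  proof (induction m)
    case (Suc m)
    have nn: "0 \<le> (\<Sum>l<L. E (m * L + Suc l) \<omega>)" by (rule sum_nonneg) (use pos in \<open>auto intro: less_imp_le\<close>)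
    have "(\<Sum>k<Suc m. ?D k) = ennreal (arrival (m * L) \<omega>) + ennreal (\<Sum>l<L. E (m * L + Suc l) \<omega>)"
      by (subst sum.lessThan_Suc, subst Suc, subst D) (rule refl)
    also have "\<dots> = ennreal (arrival (m * L + L) \<omega>)"
      using nn arr_nonneg by (simp add: arr_add ennreal_plus)
    finally show ?case by (simp add: add.commute)
  qed (simp add: arrival_def jump_time_def)
  have partial: "ennreal (arrival (m * L) \<omega>) \<le> ?s" if "\<And>k. k < m \<Longrightarrow> \<omega> \<in> below \<mu> L R k" for m
  proof -
    have "ennreal (arrival (m * L) \<omega>) = (\<Sum>k<m. ?D k * indicator (below \<mu> L R k) \<omega>)"
      unfolding sumD[symmetric] using that by (intro sum.cong) auto
    also have "\<dots> \<le> ?s" by (rule sum_le_suminf) auto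
    finally show ?thesis .
  qed
  show "hit_time (X1 \<omega>) \<mu> R \<le> ?s"
  proof (cases "\<exists>k\<ge>1. R \<le> level \<mu> (k * L) \<omega>")
    case True
    define \<kappa> where "\<kappa> = (LEAST k. 1 \<le> k \<and> R \<le> level \<mu> (k * L) \<omega>)"
    have \<kappa>: "1 \<le> \<kappa>" "R \<le> level \<mu> (\<kappa> * L) \<omega>"
      using LeastI_ex[OF True] unfolding \<kappa>_def by auto
    have "\<omega> \<in> below \<mu> L R k" if "k < \<kappa>" for k
    proof -
      have "level \<mu> (j * L) \<omega> < R" if "j \<in> {1..k}" for j
        using not_less_Least[of j "\<lambda>k. 1 \<le> k \<and> R \<le> level \<mu> (k * L) \<omega>"] that \<open>k < \<kappa>\<close>
        unfolding \<kappa>_def by auto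
      then show ?thesis using w by (simp add: below_def)
    qed
    from partial[OF this] have le: "ennreal (arrival (\<kappa> * L) \<omega>) \<le> ?s" .
    \<comment> \<open>The infimum in \<open>hit_time\<close> ranges over positive times
      only.\<close>
    have "0 < arrival (\<kappa> * L) \<omega>"
      unfolding arrival_def jump_time_def by (rule sum_pos) (use pos \<kappa> L in auto)
    then have "hit_time (X1 \<omega>) \<mu> R \<le> ennreal (arrival (\<kappa> * L) \<omega>)"
      unfolding hit_time_def using \<kappa>(2) lev by (intro Inf_lower) auto
    with le show ?thesis by simp
  next
    case False
    then have "level \<mu> (k * L) \<omega> < R" if "1 \<le> k" for k using that not_le by blast
    then have "\<omega> \<in> below \<mu> L R k" for k using w by (simp add: below_def)
    then have all: "ennreal (arrival (m * L) \<omega>) \<le> ?s" for m by (rule partial)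
    \<comment> \<open>Without passage the sum dominates every arrival time at a block end, and these
      are unbounded by \<open>arrival_linear\<close>.\<close>
    have "?s = top"
    proof (rule ccontr)
      assume "?s \<noteq> top"
      then obtain r where r: "?s = ennreal r" "0 \<le> r" by (cases ?s) auto
      have bound: "arrival (m * L) \<omega> \<le> r" for m using all[of m] r by simp
      obtain n0 where n0: "\<And>n. n0 \<le> n \<Longrightarrow> n / (2 * N) \<le> arrival n \<omega>"
        using lin unfolding eventually_sequentially by auto
      obtain m :: nat where m: "2 * N * r < m" using reals_Archimedean2 by blast
      let ?m = "max n0 m"
      have "n0 \<le> ?m * L" "m \<le> ?m * L"
        using L by (metis max.cobounded1 max.cobounded2 mult.right_neutral mult_le_mono)+
      then have "m \<le> real (?m * L)" "real (?m * L) / (2 * N) \<le> r"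
        using n0[of "?m * L"] bound[of ?m] by (auto simp del: of_nat_mult)
      then show False using m N_pos by (simp add: field_simps del: of_nat_mult)
    qed
    then show ?thesis by simp
  qed
qed

lemma expected_hit_time:
  assumes speed: "AE \<omega> in M. ((\<lambda>t. X1 \<omega> t / t) \<longlongrightarrow> v) at_top" and \<mu>: "\<mu> < v"
  shows "\<exists>\<alpha> \<beta> :: real. \<forall>R > 0. (\<integral>\<^sup>+\<omega>. hit_time (X1 \<omega>) \<mu> R \<partial>M) < ennreal (\<alpha> + \<beta> * R)"
proof -
  obtain L C where L: "1 \<le> L" and C: "0 < C"
    and q: "(\<integral>\<^sup>+\<omega>. ennreal (C - min C (level \<mu> L \<omega>)) \<partial>M) \<le> ennreal (C / 2)"
    using ex_drift_block[OF speed \<mu>] by blast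
  \<comment> \<open>The mean block duration \<open>L / N\<close> times the bound
    \<open>2 * (R + C) / C\<close> on the expected number of blocks, plus 1.\<close>
  have "(\<integral>\<^sup>+\<omega>. hit_time (X1 \<omega>) \<mu> R \<partial>M) < ennreal ((2 * L / N + 1) + 2 * L / (N * C) * R)" if R: "0 < R" for R
  proof -
    let ?A = "below \<mu> L R"
    have A[measurable]: "?A k \<in> events" for k using below_filt sets_filt_events by blast
    have [measurable]: "E (Suc i) \<in> borel_measurable M" for i by (rule measurable_E) simp
    have "(\<integral>\<^sup>+\<omega>. hit_time (X1 \<omega>) \<mu> R \<partial>M)
        \<le> (\<integral>\<^sup>+\<omega>. (\<Sum>k. (\<Sum>l<L. ennreal (E (k * L + Suc l) \<omega>)) * indicator (?A k) \<omega>) \<partial>M)"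
      by (rule nn_integral_mono_AE[OF hit_time_le[OF R L]])
    also have "\<dots> = (\<Sum>k. \<integral>\<^sup>+\<omega>. (\<Sum>l<L. ennreal (E (k * L + Suc l) \<omega>)) * indicator (?A k) \<omega> \<partial>M)"
      by (rule nn_integral_suminf) (simp add: add_Suc_right)
    also have "\<dots> = (\<Sum>k. ennreal (L / N) * emeasure M (?A k))"
    proof (rule suminf_cong)
      fix k
      have "(\<integral>\<^sup>+\<omega>. (\<Sum>l<L. ennreal (E (k * L + Suc l) \<omega>)) * indicator (?A k) \<omega> \<partial>M)
         = (\<Sum>l<L. \<integral>\<^sup>+\<omega>. ennreal (E (k * L + Suc l) \<omega>) * indicator (?A k) \<omega> \<partial>M)"
        by (subst nn_integral_sum[symmetric]) (simp_all add: sum_distrib_right)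
      also have "\<dots> = (\<Sum>l<L. ennreal (1 / N) * emeasure M (?A k))"
        by (rule sum.cong[OF refl], rule nn_integral_wait[OF below_filt]) simp
      also have "\<dots> = ennreal (L / N) * emeasure M (?A k)"
        by (simp add: emeasure_eq_measure ennreal_of_nat_eq_real_of_nat ennreal_mult[symmetric])
      finally show "(\<integral>\<^sup>+\<omega>. (\<Sum>l<L. ennreal (E (k * L + Suc l) \<omega>)) * indicator (?A k) \<omega> \<partial>M)
         = ennreal (L / N) * emeasure M (?A k)" .
    qed
    also have "\<dots> \<le> ennreal (L / N * (2 * (R + C) / C))"
    proof (rule suminf_le_const)
      fix n
      have "(\<Sum>k<n. ennreal (L / N) * emeasure M (?A k)) = ennreal (L / N * (\<Sum>k<n. prob (?A k)))"
        by (simp add: emeasure_eq_measure ennreal_mult[symmetric] sum_ennreal sum_distrib_left)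
      also have "\<dots> \<le> ennreal (L / N * (2 * (R + C) / C))"
        by (intro ennreal_leI mult_left_mono sum_prob_below[OF C R q]) simp
      finally show "(\<Sum>k<n. ennreal (L / N) * emeasure M (?A k)) \<le> ennreal (L / N * (2 * (R + C) / C))" .
    qed simp
    also have "\<dots> < ennreal ((2 * L / N + 1) + 2 * L / (N * C) * R)"
    proof (rule ennreal_lessI)
      have "L / N * (2 * (R + C) / C) = 2 * L / N + 2 * L / (N * C) * R"
        using C N_pos by (simp add: field_simps)
      then show "L / N * (2 * (R + C) / C) < (2 * L / N + 1) + 2 * L / (N * C) * R" by simp
      have "0 \<le> 2 * L / N" "0 \<le> 2 * L / (N * C) * R" using C R by auto
      then show "0 < (2 * L / N + 1) + 2 * L / (N * C) * R" by linarith
    qed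
    finally show ?thesis .
  qed
  then show ?thesis by blast
qed

end

theorem mainTheorem1:
  fixes M :: "'a measure"
    and N :: nat
    and B :: "nat \<Rightarrow> real \<Rightarrow> 'a \<Rightarrow> real"
    and E :: "nat \<Rightarrow> 'a \<Rightarrow> real"
    and K :: "nat \<Rightarrow> 'a \<Rightarrow> nat"
    and v \<mu> :: real
  assumes "prob_space M"
    and "N \<ge> 2"
    and BM: "\<And>n. n < N \<Longrightarrow> std_BM M (B n)"
    and Exp: "\<And>i. i \<ge> 1 \<Longrightarrow> distributed M lborel (E i) (exponential_density (real N))"
    and Unif: "\<And>i. i \<ge> 1 \<Longrightarrow> distr M (count_space UNIV) (K i) = measure_pmf (pmf_of_set {1..N})"
    and indep: "prob_space.indep_sets M (\<lambda>s. sigma_sets (space M) (noise_gen M B E K s))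
                  ({BM_src n | n. n < N} \<union> {E_src i | i. i \<ge> 1} \<union> {K_src i | i. i \<ge> 1})"
    and speed: "AE \<omega> in M. ((\<lambda>t. nbbm_X1 N (\<lambda>n t. B n t \<omega>) (\<lambda>i. E i \<omega>) (\<lambda>i. K i \<omega>) t / t)
                              \<longlongrightarrow> v) at_top"
    and "0 \<le> \<mu>" and "\<mu> < v"
  shows "\<exists>\<alpha> \<beta> :: real. \<forall>R > 0.
           (\<integral>\<^sup>+ \<omega>. hit_time (nbbm_X1 N (\<lambda>n t. B n t \<omega>) (\<lambda>i. E i \<omega>) (\<lambda>i. K i \<omega>)) \<mu> R \<partial>M)
             < ennreal (\<alpha> + \<beta> * R)"
proof -
  interpret nbbm_noise M N B E K
    using assms by (intro nbbm_noise.intro nbbm_noise_axioms.intro) auto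
  show ?thesis by (rule expected_hit_time[OF speed \<open>\<mu> < v\<close>])
qed

end
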